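(* For every $n\ge 1$ there exists a constant $C(n)>0$, depending only on $n$, such that for every $K>0$, every $K$-sparse set $E\subset\mathbf{C}$ and every function $b:E\to\mathbf{P}^n$ there exists a holomorphic curve $f\in\mathcal{Y}_n(C(n)/K)$ with $f(m)=b(m)$ for all $m\in E$.
   Context: $\mathbf{P}^n$ is the complex projective space of dimension $n$ with the Fubini--Study metric $ds^2=\frac{\langle d\zeta,d\zeta\rangle\langle\zeta,\zeta\rangle-|\langle\zeta,d\zeta\rangle|^2}{\langle\zeta,\zeta\rangle^2}$ (in homogeneous coordinates $\zeta$). A holomorphic curve is a holomorphic map $f:\mathbf{C}\to\mathbf{P}^n$; it can be written $f=(f_0:\ldots:f_n)$ with $f_j$ entire functions without common zeros. Its spherical derivative $f^\#\ge0$ is given by $(f^\#)^2=\frac{\sum_{i<j}|f_i'f_j-f_if_j'|^2}{(\sum_j|f_j|^2)^2}$. For $K>0$, $\mathcal{Y}_n(K)$ is the set of holomorphic curves $f:\mathbf{C}\to\mathbf{P}^n$ with $\sup_{z\in\mathbf{C}}f^\#(z)\le K$. A set $E\subset\mathbf{C}$ is called $K$-sparse if the distance between any two distinct points of $E$ is at least $K$. *)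

theory Defs
  imports "HOL-Complex_Analysis.Complex_Analysis"
begin

section \<open>Complex projective space\<close>

text \<open>
  The dimension \<open>n\<close> is a natural number rather than a type, so that a constant may be
  quantified after it. A vector of $\mathbf{C}^{n+1}$ is a function \<open>nat \<Rightarrow> complex\<close>
  vanishing beyond \<open>n\<close>.
\<close>

definition nonzero_vectors :: "nat \<Rightarrow> (nat \<Rightarrow> complex) set" where
  "nonzero_vectors n = {x. (\<forall>i>n. x i = 0) \<and> (\<exists>i\<le>n. x i \<noteq> 0)}"

definition proportional :: "nat \<Rightarrow> ((nat \<Rightarrow> complex) \<times> (nat \<Rightarrow> complex)) set" where
  "proportional n = {(x, y). x \<in> nonzero_vectors n \<and> y \<in> nonzero_vectors n \<and>
                             (\<exists>c. c \<noteq> 0 \<and> y = (\<lambda>i. c * x i))}"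

definition proj_space :: "nat \<Rightarrow> (nat \<Rightarrow> complex) set set" where
  "proj_space n = nonzero_vectors n // proportional n"

text \<open>The point $(x_0 : \ldots : x_n)$; the values of \<open>x\<close> beyond \<open>n\<close> are ignored.\<close>

definition proj_point :: "nat \<Rightarrow> (nat \<Rightarrow> complex) \<Rightarrow> (nat \<Rightarrow> complex) set" where
  "proj_point n x = proportional n `` {\<lambda>i. if i \<le> n then x i else 0}"

text \<open>The standard affine chart $x_i \neq 0$, with coordinates $x_j / x_i$.\<close>

definition chart_domain :: "nat \<Rightarrow> nat \<Rightarrow> (nat \<Rightarrow> complex) set set" where
  "chart_domain n i = {p \<in> proj_space n. \<forall>x\<in>p. x i \<noteq> 0}"

definition chart_coord :: "nat \<Rightarrow> nat \<Rightarrow> (nat \<Rightarrow> complex) set \<Rightarrow> complex" where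
  "chart_coord i j p = (THE c. \<forall>x\<in>p. x j / x i = c)"


section \<open>Holomorphic curves and the spherical derivative\<close>

text \<open>Continuity is the openness of the preimages of the charts together with the
  holomorphy of the chart coordinates on them.\<close>

definition holomorphic_curve :: "nat \<Rightarrow> (complex \<Rightarrow> (nat \<Rightarrow> complex) set) \<Rightarrow> bool" where
  "holomorphic_curve n F \<longleftrightarrow>
     range F \<subseteq> proj_space n \<and>
     (\<forall>i\<le>n. open (F -` chart_domain n i) \<and>
            (\<forall>j\<le>n. (\<lambda>z. chart_coord i j (F z)) holomorphic_on (F -` chart_domain n i)))"

definition homogeneous_rep ::
    "nat \<Rightarrow> (nat \<Rightarrow> complex \<Rightarrow> complex) \<Rightarrow> (complex \<Rightarrow> (nat \<Rightarrow> complex) set) \<Rightarrow> bool" where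
  "homogeneous_rep n f F \<longleftrightarrow>
     (\<forall>j\<le>n. f j holomorphic_on UNIV) \<and>
     (\<forall>z. \<exists>j\<le>n. f j z \<noteq> 0) \<and>
     (\<forall>z. F z = proj_point n (\<lambda>j. f j z))"

definition spherical_formula :: "nat \<Rightarrow> (nat \<Rightarrow> complex \<Rightarrow> complex) \<Rightarrow> complex \<Rightarrow> real" where
  "spherical_formula n f z =
     sqrt ((\<Sum>(i, j) \<in> {(i, j). i < j \<and> j \<le> n}.
              (cmod (deriv (f i) z * f j z - f i z * deriv (f j) z))\<^sup>2)
           / (\<Sum>j\<le>n. (cmod (f j z))\<^sup>2)\<^sup>2)"

text \<open>
  Every holomorphic curve has a homogeneous representation, and the value of
  \<open>spherical_formula\<close> does not depend on which one is chosen
  (\<open>spherical_formula_unique\<close> below).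
\<close>

definition spherical_deriv ::
    "nat \<Rightarrow> (complex \<Rightarrow> (nat \<Rightarrow> complex) set) \<Rightarrow> complex \<Rightarrow> real" where
  "spherical_deriv n F = spherical_formula n (SOME f. homogeneous_rep n f F)"

definition brody_curves :: "nat \<Rightarrow> real \<Rightarrow> (complex \<Rightarrow> (nat \<Rightarrow> complex) set) set" where
  "brody_curves n K = {F. holomorphic_curve n F \<and> (\<forall>z. spherical_deriv n F z \<le> K)}"

definition sparse_set :: "real \<Rightarrow> complex set \<Rightarrow> bool" where
  "sparse_set K E \<longleftrightarrow> (\<forall>x\<in>E. \<forall>y\<in>E. x \<noteq> y \<longrightarrow> K \<le> dist x y)"


section \<open>The definitions are meaningful\<close>

lemma equiv_proportional: "equiv (nonzero_vectors n) (proportional n)"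
proof (rule equivI)
  show "proportional n \<subseteq> nonzero_vectors n \<times> nonzero_vectors n"
    by (auto simp: proportional_def)
  show "refl_on (nonzero_vectors n) (proportional n)"
    by (auto simp: refl_on_def proportional_def intro!: exI[of _ 1])
  show "sym (proportional n)"
  proof (rule symI)
    fix x y assume "(x, y) \<in> proportional n"
    then obtain c where c: "x \<in> nonzero_vectors n" "y \<in> nonzero_vectors n" "c \<noteq> 0"
        "y = (\<lambda>i. c * x i)"
      by (auto simp: proportional_def)
    then have "x = (\<lambda>i. inverse c * y i)" by auto
    with c show "(y, x) \<in> proportional n"
      unfolding proportional_def using nonzero_imp_inverse_nonzero by blast
  qed
  show "trans (proportional n)"
  proof (rule transI)
    fix x y z assume "(x, y) \<in> proportional n" "(y, z) \<in> proportional n"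
    then obtain c d where "x \<in> nonzero_vectors n" "z \<in> nonzero_vectors n" "c \<noteq> 0" "d \<noteq> 0"
        "y = (\<lambda>i. c * x i)" "z = (\<lambda>i. d * y i)"
      by (auto simp: proportional_def)
    then show "(x, z) \<in> proportional n"
      by (auto simp: proportional_def mult.assoc intro!: exI[of _ "d * c"])
  qed
qed

lemma proj_point_in_proj_space:
  assumes "\<exists>i\<le>n. x i \<noteq> 0"
  shows "proj_point n x \<in> proj_space n"
  unfolding proj_point_def proj_space_def
  using assms by (intro quotientI) (auto simp: nonzero_vectors_def)

lemma mem_proj_point:
  assumes "\<exists>i\<le>n. x i \<noteq> 0"
  shows "y \<in> proj_point n x \<longleftrightarrow> (\<exists>c. c \<noteq> 0 \<and> y = (\<lambda>i. if i \<le> n then c * x i else 0))"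
  (is "?L \<longleftrightarrow> ?R")
proof
  assume ?L
  then show ?R by (auto simp: proj_point_def proportional_def fun_eq_iff)
next
  assume ?R
  then obtain c where c: "c \<noteq> 0" "y = (\<lambda>i. if i \<le> n then c * x i else 0)" by blast
  then have "y = (\<lambda>i. c * (if i \<le> n then x i else 0))" by auto
  moreover have "y \<in> nonzero_vectors n" "(\<lambda>i. if i \<le> n then x i else 0) \<in> nonzero_vectors n"
    using assms c by (auto simp: nonzero_vectors_def)
  ultimately have "((\<lambda>i. if i \<le> n then x i else 0), y) \<in> proportional n"
    using c(1) unfolding proportional_def mem_Collect_eq case_prod_conv by (intro conjI exI[of _ c])
  then show ?L
    unfolding proj_point_def by simp
qed

lemma self_mem_proj_point:
  assumes "\<exists>i\<le>n. x i \<noteq> 0"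
  shows "(\<lambda>i. if i \<le> n then x i else 0) \<in> proj_point n x"
  unfolding mem_proj_point[OF assms] by (rule exI[of _ 1]) (simp add: fun_eq_iff)

lemma proj_point_in_chart_domain_iff:
  assumes "\<exists>i\<le>n. x i \<noteq> 0" "i \<le> n"
  shows "proj_point n x \<in> chart_domain n i \<longleftrightarrow> x i \<noteq> 0"
proof -
  have "x i \<noteq> 0" if "\<forall>y\<in>proj_point n x. y i \<noteq> 0"
    using bspec[OF that self_mem_proj_point[OF assms(1)]] assms(2) by simp
  moreover have "y i \<noteq> 0" if x: "x i \<noteq> 0" and y: "y \<in> proj_point n x" for y
  proof -
    obtain c where "c \<noteq> 0" "y = (\<lambda>i. if i \<le> n then c * x i else 0)"
      using y unfolding mem_proj_point[OF assms(1)] by blast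
    with x assms(2) show ?thesis by simp
  qed
  ultimately have "(\<forall>y\<in>proj_point n x. y i \<noteq> 0) \<longleftrightarrow> x i \<noteq> 0" by blast
  then show ?thesis
    using proj_point_in_proj_space[OF assms(1)] by (simp add: chart_domain_def)
qed

lemma chart_coord_proj_point:
  assumes "i \<le> n" "j \<le> n" "x i \<noteq> 0"
  shows "chart_coord i j (proj_point n x) = x j / x i"
proof -
  have ex: "\<exists>i\<le>n. x i \<noteq> 0" using assms by blast
  have eq: "y j / y i = x j / x i" if y: "y \<in> proj_point n x" for y
  proof -
    obtain c where "c \<noteq> 0" "y = (\<lambda>i. if i \<le> n then c * x i else 0)"
      using y unfolding mem_proj_point[OF ex] by blast
    with assms show ?thesis by simp
  qed
  show ?thesis
    unfolding chart_coord_def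
  proof (rule the_equality)
    show "\<forall>y\<in>proj_point n x. y j / y i = x j / x i" using eq by blast
    show "c = x j / x i" if "\<forall>y\<in>proj_point n x. y j / y i = c" for c
      using bspec[OF that self_mem_proj_point[OF ex]] assms by simp
  qed
qed

lemma homogeneous_rep_imp_holomorphic_curve:
  assumes "homogeneous_rep n f F"
  shows "holomorphic_curve n F"
proof -
  have hol: "f j holomorphic_on UNIV" if "j \<le> n" for j
    using assms that by (auto simp: homogeneous_rep_def)
  have nz: "\<exists>j\<le>n. f j z \<noteq> 0" for z
    using assms by (auto simp: homogeneous_rep_def)
  have F: "F z = proj_point n (\<lambda>j. f j z)" for z
    using assms by (auto simp: homogeneous_rep_def)
  have dom: "F -` chart_domain n i = f i -` (- {0})" if "i \<le> n" for i
    using proj_point_in_chart_domain_iff[OF nz that] by (auto simp: F)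
  show ?thesis
    unfolding holomorphic_curve_def
  proof (intro conjI allI impI)
    show "range F \<subseteq> proj_space n"
      using proj_point_in_proj_space[OF nz] by (auto simp: F)
    fix i assume i: "i \<le> n"
    show "open (F -` chart_domain n i)"
      unfolding dom[OF i] using holomorphic_on_imp_continuous_on[OF hol[OF i]]
      by (intro open_vimage) auto
    fix j assume j: "j \<le> n"
    have "(\<lambda>z. f j z / f i z) holomorphic_on (f i -` (- {0}))"
      using holomorphic_on_subset[OF hol[OF i]] holomorphic_on_subset[OF hol[OF j]]
      by (intro holomorphic_on_divide) auto
    then show "(\<lambda>z. chart_coord i j (F z)) holomorphic_on (F -` chart_domain n i)"
      unfolding dom[OF i]
      by (rule holomorphic_transform) (auto simp: F chart_coord_proj_point i j)
  qed
qed

lemma spherical_formula_unique: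
  assumes f: "homogeneous_rep n f F" and g: "homogeneous_rep n g F"
  shows "spherical_formula n f = spherical_formula n g"
proof
  fix z
  have nzf: "\<exists>j\<le>n. f j w \<noteq> 0" and nzg: "\<exists>j\<le>n. g j w \<noteq> 0" for w
    using f g by (auto simp: homogeneous_rep_def)
  have df: "f j field_differentiable at w" and dg: "g j field_differentiable at w"
    if "j \<le> n" for j w
    using f g that by (auto simp: homogeneous_rep_def holomorphic_on_def)
  have "\<exists>c. c \<noteq> 0 \<and> (\<forall>j\<le>n. g j w = c * f j w)" for w
  proof -
    have "proj_point n (\<lambda>j. g j w) = proj_point n (\<lambda>j. f j w)"
      using f g by (metis homogeneous_rep_def)
    then have "(\<lambda>j. if j \<le> n then g j w else 0) \<in> proj_point n (\<lambda>j. f j w)"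
      using self_mem_proj_point[OF nzg, of w] by simp
    then obtain c where "c \<noteq> 0"
        "(\<lambda>j. if j \<le> n then g j w else 0) = (\<lambda>j. if j \<le> n then c * f j w else 0)"
      unfolding mem_proj_point[OF nzf] by blast
    then have "c \<noteq> 0 \<and> (\<forall>j\<le>n. g j w = c * f j w)"
      by (metis (mono_tags, lifting))
    then show ?thesis ..
  qed
  then obtain c where c: "\<And>w. c w \<noteq> 0" "\<And>j w. j \<le> n \<Longrightarrow> g j w = c w * f j w"
    by metis
  obtain k where k: "k \<le> n" "f k z \<noteq> 0" using nzf by blast
  define q where "q = (\<lambda>w. g k w / f k w)"
  have q_diff: "q field_differentiable at z"
    unfolding q_def using df[OF k(1)] dg[OF k(1)] k(2) by (intro field_differentiable_divide)
  have "open (f k -` (- {0}))"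
    using df[OF k(1)] field_differentiable_imp_continuous_at
    by (intro open_vimage) (auto simp: continuous_on_eq_continuous_at)
  then have ev: "\<forall>\<^sub>F w in nhds z. f k w \<noteq> 0"
    using k(2) eventually_nhds_in_open[of "f k -` (- {0})" z] by simp
  have q_eq: "c w = q w" if "f k w \<noteq> 0" for w
    using c(2)[OF k(1), of w] that by (simp add: q_def)
  have cz: "c z = q z" by (rule q_eq[OF k(2)])
  have deriv_g: "deriv (g j) z = deriv q z * f j z + c z * deriv (f j) z" if "j \<le> n" for j
  proof -
    have "\<forall>\<^sub>F w in nhds z. g j w = q w * f j w"
      using ev by eventually_elim (simp add: c(2)[OF that] q_eq)
    then have "deriv (g j) z = deriv (\<lambda>w. q w * f j w) z"
      by (rule deriv_cong_ev) simp
    then show ?thesis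
      using q_diff df[OF that] by (simp add: cz algebra_simps)
  qed
  have wronskian: "deriv (g i) z * g j z - g i z * deriv (g j) z =
      (c z)\<^sup>2 * (deriv (f i) z * f j z - f i z * deriv (f j) z)" if "i \<le> n" "j \<le> n" for i j
    using that by (simp add: deriv_g c(2) power2_eq_square algebra_simps)
  have num: "(\<Sum>(i, j) \<in> {(i, j). i < j \<and> j \<le> n}.
        (cmod (deriv (g i) z * g j z - g i z * deriv (g j) z))\<^sup>2) =
      (cmod (c z))^4 * (\<Sum>(i, j) \<in> {(i, j). i < j \<and> j \<le> n}.
        (cmod (deriv (f i) z * f j z - f i z * deriv (f j) z))\<^sup>2)"
    unfolding sum_distrib_left
    by (rule sum.cong) (auto simp: wronskian norm_mult norm_power power_mult_distrib
        simp flip: power_mult)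
  have "(\<Sum>j\<le>n. (cmod (g j z))\<^sup>2) = (cmod (c z))\<^sup>2 * (\<Sum>j\<le>n. (cmod (f j z))\<^sup>2)"
    unfolding sum_distrib_left
    by (rule sum.cong) (auto simp: c(2) norm_mult power_mult_distrib)
  then have den: "(\<Sum>j\<le>n. (cmod (g j z))\<^sup>2)\<^sup>2 = (cmod (c z))^4 * (\<Sum>j\<le>n. (cmod (f j z))\<^sup>2)\<^sup>2"
    by (simp add: power_mult_distrib flip: power_mult)
  show "spherical_formula n f z = spherical_formula n g z"
    unfolding spherical_formula_def num den using c(1)[of z] by simp
qed

lemma spherical_deriv_eq:
  assumes "homogeneous_rep n f F"
  shows "spherical_deriv n F = spherical_formula n f"
  unfolding spherical_deriv_def
  by (rule spherical_formula_unique[OF someI[of "\<lambda>f. homogeneous_rep n f F", OF assms] assms])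

end

theory Submission
  imports Defs
begin

text \<open>
  After a dilation of the plane it may be assumed that the points of \<open>E\<close> are separated by a large
  absolute constant \<open>R\<close>. The curve is then written in affine coordinates as
  $(1 : G_1 : \ldots : G_n)$ with
  \[ G_j(z) = \sum_{m\in E} \frac{p_{m,j} + s_m (z-m)}{(a_m-z)^5}, \qquad |a_m - m| \le 1. \]
  The terms decay like $|z-m|^{-4}$, so on a sparse set the sum converges
  (\<open>sparse_set_sum_bound\<close>) and all terms but that of the nearest point add up to something small.
  Near \<open>m\<close> the curve is therefore a small perturbation of the rational curve with homogeneous
  coordinates $(a_m-z)^5$ and $p_{m,j} + s_m (z-m)$.

  Let $(\beta_0 : \ldots : \beta_n)$ be the prescribed point at \<open>m\<close>, with largest modulus 1. The pole
  is chosen with $(a_m-m)^5 = \beta_0$, so that the coordinate of index 0 is right, and also points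
  with $\beta_0$ near or equal to 0 are allowed. The other coordinates require
  \[ p_{m,j} + \beta_0 \sum_{k\ne m} \frac{p_{k,j} + s_k (m-k)}{(a_k-m)^5} = \beta_j. \]
  For every \<open>j\<close> this is a linear system in the bounded unknowns $p_{m,j}$ whose off-diagonal
  part is small, and it is solved by a contraction (\<open>interpolation_fixpoint\<close>).

  The spherical derivative stays bounded if the coordinates of the local curve are bounded and have
  no common zeros, with uniform bounds (\<open>spherical_formula_le\<close>). After normalization
  $\beta_0 = 1$ or $|\beta_j| = 1$ for some $j \ge 1$. In the first case $a_m = m + 1$, and the slope
  $s_m = 4$ makes the numerators large near the pole. In the second, if $\beta_0 \ne 1$, the slope is 0,
  and $p_{m,j}$ is a constant of modulus at least $3/4$. At distance 3 or more from \<open>E\<close>, the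
  functions $G_j$ and their derivatives are bounded, and this is enough.

  Homogeneous coordinates by entire functions arise from multiplication by $W^5$, where \<open>W\<close> is
  entire with simple zeros exactly at the points $a_m$ (\<open>weierstrass_simple_zeros\<close>). The
  factor $W^5$ does not affect the spherical derivative.
\<close>

section \<open>Sums over sparse sets\<close>

lemma summable_on_int_inverse_squares: "(\<lambda>k::int. 1 / (1 + (real_of_int k)\<^sup>2)) summable_on UNIV"
proof -
  define g where "g = (\<lambda>k::int. 1 / (1 + (real_of_int k)\<^sup>2))"
  have "summable (\<lambda>k::nat. 1 / (real k)\<^sup>2)"
    using inverse_power_summable[of 2, where 'a=real] by (simp add: inverse_eq_divide)
  then have "summable (\<lambda>k::nat. g (int k))"
  proof (rule summable_comparison_test_ev[rotated])
    show "\<forall>\<^sub>F k in sequentially. norm (g (int k)) \<le> 1 / (real k)\<^sup>2"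
      using eventually_gt_at_top[of 0]
      by eventually_elim (auto simp: g_def intro!: divide_left_mono mult_pos_pos add_pos_nonneg)
  qed
  then have nat: "(\<lambda>k::nat. g (int k)) summable_on UNIV"
    by (subst summable_on_UNIV_nonneg_real_iff) (auto simp: g_def)
  have pos: "g summable_on range int"
    using nat by (subst summable_on_reindex) (auto simp: o_def)
  have neg: "g summable_on range (\<lambda>k. - int k)"
    using nat by (subst summable_on_reindex) (auto simp: o_def g_def inj_def)
  \<comment> \<open>The two ranges share 0, which is counted once.\<close>
  have "UNIV = range int \<union> (range (\<lambda>k. - int k) - range int)"
    by (auto simp: image_iff) (metis int_cases2)
  moreover have "g summable_on (range int \<union> (range (\<lambda>k. - int k) - range int))"
    by (intro summable_on_Un_disjoint pos summable_on_subset_banach[OF neg]) auto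
  ultimately show ?thesis by (simp add: g_def)
qed

text \<open>
  After rescaling, each half-open unit lattice square holds at most one point of the sparse set, so
  the sum is dominated by the double series of $1/((1+k^2)(1+l^2))$. The exponent 4 is what this
  product form requires: each of the factors $1+k^2$ and $1+l^2$ is at most a constant
  times $|m-z|^2/R^2$.
\<close>

lemma sparse_set_sum_bound:
  obtains C :: real where "C > 0"
    "\<And>R E z. \<lbrakk>0 < R; sparse_set R E; \<And>m. m \<in> E \<Longrightarrow> R / 2 \<le> cmod (m - z)\<rbrakk> \<Longrightarrow>
       (\<lambda>m. 1 / cmod (m - z) ^ 4) summable_on E \<and>
       (\<Sum>\<^sub>\<infinity>m\<in>E. 1 / cmod (m - z) ^ 4) \<le> C / R ^ 4"
proof -
  define g where "g = (\<lambda>k::int. 1 / (1 + (real_of_int k)\<^sup>2))"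
  define G where "G = (\<lambda>(k, l). g k * g l)"
  have g_nonneg: "g k \<ge> 0" for k by (simp add: g_def)
  have sum_g: "g summable_on UNIV"
    unfolding g_def by (rule summable_on_int_inverse_squares)
  have "G summable_on (UNIV \<times> UNIV)"
  proof (rule summable_on_SigmaI)
    show "((\<lambda>l. G (k, l)) has_sum (g k * infsum g UNIV)) UNIV" for k
      unfolding G_def by (auto intro!: has_sum_cmult_right has_sum_infsum sum_g)
    show "(\<lambda>k. g k * infsum g UNIV) summable_on UNIV"
      by (intro summable_on_cmult_left sum_g)
  qed (auto simp: G_def g_nonneg)
  then have sum_G: "G summable_on UNIV" by simp
  define S where "S = infsum G UNIV"
  have G_nonneg: "G kl \<ge> 0" for kl by (auto simp: G_def g_nonneg split: prod.split)
  have S_nonneg: "S \<ge> 0" unfolding S_def by (intro infsum_nonneg) (simp add: G_nonneg)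
  show thesis
  proof (rule that[of "400 * (S + 1)"])
    show "400 * (S + 1) > 0" using S_nonneg by simp
    fix R :: real and E z
    assume R: "0 < R" and sp: "sparse_set R E" and far: "\<And>m. m \<in> E \<Longrightarrow> R / 2 \<le> cmod (m - z)"
    define x where "x = (\<lambda>m. 2 * (m - z) / of_real R)"
    define \<phi> where "\<phi> = (\<lambda>m. (\<lfloor>Re (x m)\<rfloor>, \<lfloor>Im (x m)\<rfloor>))"
    have norm_x: "cmod (x m) = 2 * cmod (m - z) / R" for m
      using R unfolding x_def norm_divide norm_mult by simp
    have x_ge: "1 \<le> cmod (x m)" if "m \<in> E" for m
      using far[OF that] R by (simp add: norm_x field_simps)
    have inj: "inj_on \<phi> E"
    proof (rule inj_onI, rule ccontr)
      fix m m' assume m: "m \<in> E" "m' \<in> E" "\<phi> m = \<phi> m'" "m \<noteq> m'"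
      have "\<bar>Re (x m) - Re (x m')\<bar> < 1" "\<bar>Im (x m) - Im (x m')\<bar> < 1"
        using m(3) by (simp_all add: \<phi>_def, linarith+)
      then have "cmod (x m - x m') < 2"
        using cmod_le[of "x m - x m'"] by simp
      moreover have "x m - x m' = 2 * (m - m') / of_real R"
        by (simp add: x_def diff_divide_distrib algebra_simps)
      then have "cmod (x m - x m') = 2 * dist m m' / R"
        using R unfolding dist_norm by (simp only: norm_mult norm_divide) simp
      moreover have "R \<le> dist m m'" using sp m by (auto simp: sparse_set_def)
      ultimately show False using R by (simp add: field_simps)
    qed
    \<comment> \<open>A coordinate of modulus at most \<open>cmod u\<close> has a floor of modulus at most \<open>2 * cmod u\<close>,
      since \<open>cmod u\<close> is at least 1.\<close>
    have gx: "1 / (5 * (cmod u)\<^sup>2) \<le> g \<lfloor>t\<rfloor>" if "1 \<le> cmod u" "\<bar>t\<bar> \<le> cmod u" for u t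
    proof -
      have "\<bar>real_of_int \<lfloor>t\<rfloor>\<bar> \<le> 2 * cmod u" using that by linarith
      then have "(real_of_int \<lfloor>t\<rfloor>)\<^sup>2 \<le> (2 * cmod u)\<^sup>2"
        by (metis abs_le_square_iff abs_of_nonneg mult_nonneg_nonneg norm_ge_zero zero_le_numeral)
      moreover have "1 \<le> (cmod u)\<^sup>2" using that by (simp add: one_le_power)
      ultimately have "1 + (real_of_int \<lfloor>t\<rfloor>)\<^sup>2 \<le> 5 * (cmod u)\<^sup>2"
        by (simp add: power_mult_distrib)
      then show ?thesis
        unfolding g_def by (intro divide_left_mono mult_pos_pos add_pos_nonneg) (use that in auto)
    qed
    have le: "1 / cmod (m - z) ^ 4 \<le> 400 / R ^ 4 * G (\<phi> m)" if m: "m \<in> E" for m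
    proof -
      have "1 / (5 * (cmod (x m))\<^sup>2) * (1 / (5 * (cmod (x m))\<^sup>2)) \<le> G (\<phi> m)"
        unfolding G_def \<phi>_def prod.case
        by (intro mult_mono gx x_ge m g_nonneg abs_Re_le_cmod abs_Im_le_cmod) auto
      then have "400 / R ^ 4 * (1 / (5 * (cmod (x m))\<^sup>2) * (1 / (5 * (cmod (x m))\<^sup>2))) \<le> 400 / R ^ 4 * G (\<phi> m)"
        using R by (intro mult_left_mono) auto
      also have "400 / R ^ 4 * (1 / (5 * (cmod (x m))\<^sup>2) * (1 / (5 * (cmod (x m))\<^sup>2))) = 1 / cmod (m - z) ^ 4"
        using R far[OF m] by (simp add: norm_x field_simps power_divide power_mult_distrib eval_nat_numeral)
      finally show ?thesis .
    qed
    have sum_\<phi>: "(\<lambda>m. G (\<phi> m)) summable_on E"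
    proof -
      have "G summable_on (\<phi> ` E)" using sum_G by (rule summable_on_subset_banach) auto
      then show ?thesis using inj by (simp add: summable_on_reindex o_def)
    qed
    have summ: "(\<lambda>m. 1 / cmod (m - z) ^ 4) summable_on E"
      by (rule summable_on_comparison_test[OF summable_on_cmult_right[OF sum_\<phi>, of "400 / R ^ 4"]])
         (simp_all only: le, simp)
    have "infsum (\<lambda>m. G (\<phi> m)) E = infsum G (\<phi> ` E)"
      using inj by (simp add: infsum_reindex o_def)
    also have "\<dots> \<le> S" unfolding S_def
      using sum_G summable_on_subset_banach[OF sum_G, of "\<phi> ` E"]
      by (intro infsum_mono_neutral) (auto simp: G_nonneg)
    finally have S: "infsum (\<lambda>m. G (\<phi> m)) E \<le> S" .
    have "(\<Sum>\<^sub>\<infinity>m\<in>E. 1 / cmod (m - z) ^ 4) \<le> (\<Sum>\<^sub>\<infinity>m\<in>E. 400 / R ^ 4 * G (\<phi> m))"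
      by (intro infsum_mono summ summable_on_cmult_right sum_\<phi> le)
    also have "\<dots> = 400 / R ^ 4 * infsum (\<lambda>m. G (\<phi> m)) E"
      by (rule infsum_cmult_right) (use sum_\<phi> in auto)
    also have "\<dots> \<le> 400 / R ^ 4 * (S + 1)"
      using S R by (intro mult_left_mono) auto
    finally show "(\<lambda>m. 1 / cmod (m - z) ^ 4) summable_on E \<and>
       (\<Sum>\<^sub>\<infinity>m\<in>E. 1 / cmod (m - z) ^ 4) \<le> 400 * (S + 1) / R ^ 4"
      using summ by simp
  qed
qed

lemma finite_sparse_set_cball:
  assumes "0 < R" "sparse_set R E"
  shows "finite (E \<inter> cball z r)"
proof -
  have "uniform_discrete (E \<inter> cball z r)"
    unfolding uniform_discrete_def using assms
    by (intro exI[of _ R]) (force simp: sparse_set_def)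
  then show ?thesis
    using uniform_discrete_finite_iff[of "E \<inter> cball z r"] by (simp add: bounded_Int)
qed

section \<open>Fixed points of contractions on bounded functions\<close>

text \<open>
  Banach's theorem in the complete space of functions from \<open>E\<close> to the closed disc of radius \<open>B\<close>
  with the supremum distance, stated pointwise. The map need not preserve extensionality, so it is
  composed with the restriction to \<open>E\<close>.
\<close>

lemma bounded_contraction_fixpoint:
  fixes T :: "('a \<Rightarrow> complex) \<Rightarrow> 'a \<Rightarrow> complex"
  assumes "0 \<le> B" "k < 1"
    and bound: "\<And>p x. \<lbrakk>\<And>y. y \<in> E \<Longrightarrow> cmod (p y) \<le> B; x \<in> E\<rbrakk> \<Longrightarrow> cmod (T p x) \<le> B"
    and contr: "\<And>p q d x. \<lbrakk>\<And>y. y \<in> E \<Longrightarrow> cmod (p y) \<le> B; \<And>y. y \<in> E \<Longrightarrow> cmod (q y) \<le> B;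
        \<And>y. y \<in> E \<Longrightarrow> cmod (p y - q y) \<le> d; x \<in> E\<rbrakk> \<Longrightarrow> cmod (T p x - T q x) \<le> k * d"
  obtains p where "\<And>x. x \<in> E \<Longrightarrow> cmod (p x) \<le> B" "\<And>x. x \<in> E \<Longrightarrow> T p x = p x"
proof (cases "E = {}")
  case True
  then show thesis using that[of "\<lambda>_. 0"] by simp
next
  case False
  interpret M: Metric_space "cball (0::complex) B" dist
    by unfold_locales (auto simp: dist_commute dist_triangle)
  have complete: "M.mcomplete"
    unfolding M.mcomplete_def
  proof (intro allI impI)
    fix \<sigma> assume c: "M.MCauchy \<sigma>"
    then have "Cauchy \<sigma>" and s: "range \<sigma> \<subseteq> cball 0 B"
      by (auto simp: M.MCauchy_def Cauchy_def)
    then obtain l where l: "\<sigma> \<longlonglongrightarrow> l" using Cauchy_convergent convergent_def by blast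
    then have "l \<in> cball 0 B"
      using s closed_sequentially[OF closed_cball, of \<sigma> 0 B l] by (simp add: image_subset_iff)
    then show "\<exists>x. limitin M.mtopology \<sigma> x sequentially"
      using l s by (intro exI[of _ l]) (fastforce simp: M.limit_metric_sequentially LIMSEQ_def)
  qed
  interpret F: Metric_space "M.fspace E" "M.fdist E"
    by (rule M.Metric_space_funspace)
  have fspace: "p \<in> M.fspace E \<longleftrightarrow> p \<in> extensional E \<and> (\<forall>y\<in>E. cmod (p y) \<le> B)" for p
  proof -
    have "M.mbounded (p ` E)" if "\<forall>y\<in>E. cmod (p y) \<le> B"
      unfolding M.mbounded_def using that assms(1)
      by (intro exI[of _ 0] exI[of _ B]) (auto simp: M.mcball_def)
    then show ?thesis by (auto simp: M.fspace_def)
  qed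
  have compl: "F.mcomplete"
    using M.mcomplete_funspace[OF complete, of E] by (simp add: mcomplete_of_def M.Self_def)
  let ?T = "\<lambda>p. restrict (T p) E"
  have T: "?T \<in> M.fspace E \<rightarrow> M.fspace E"
    using bound by (auto simp: fspace)
  have con: "M.fdist E (?T p) (?T q) \<le> k * M.fdist E p q"
    if pq: "p \<in> M.fspace E" "q \<in> M.fspace E" for p q
  proof -
    have d: "cmod (p y - q y) \<le> M.fdist E p q" if "y \<in> E" for y
      using M.funspace_mdist_le[OF pq False, of "M.fdist E p q"] that by (simp add: dist_norm)
    have "?T p \<in> M.fspace E" "?T q \<in> M.fspace E" using T pq by auto
    then show ?thesis
      using contr[of p q, OF _ _ d] pq
      by (subst M.funspace_mdist_le) (auto simp: False fspace dist_norm)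
  qed
  have "M.fspace E \<noteq> {}"
    using assms(1) fspace[of "restrict (\<lambda>_. 0) E"] by auto
  then obtain p where "p \<in> M.fspace E" "?T p = p"
    using F.Banach_fixedpoint_thm[OF compl _ T assms(2) con] by blast
  then show thesis
    using that[of p] by (metis fspace restrict_apply')
qed

section \<open>Entire functions with prescribed simple zeros\<close>

text \<open>
  A Weierstrass product for a sequence that enumerates \<open>Z\<close> without repetition. Such products need
  nonzero zeros and infinitely many of them; a translation moves a point outside \<open>Z\<close> to the origin,
  and a finite \<open>Z\<close> is treated by a polynomial.
\<close>

lemma weierstrass_simple_zeros:
  fixes Z :: "complex set"
  assumes fin: "\<And>r. finite (Z \<inter> cball 0 r)"
  obtains W where "W holomorphic_on UNIV" "\<And>z. W z = 0 \<longleftrightarrow> z \<in> Z"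
    "\<And>a. a \<in> Z \<Longrightarrow> deriv W a \<noteq> 0"
proof -
  have main: "\<exists>W. W holomorphic_on UNIV \<and> (\<forall>z. W z = 0 \<longleftrightarrow> z \<in> Z) \<and> (\<forall>a\<in>Z. deriv W a \<noteq> 0)"
    if Z0: "0 \<notin> Z" and fin: "\<And>r. finite (Z \<inter> cball 0 r)" for Z :: "complex set"
  proof (cases "finite Z")
    case True
    then show ?thesis
    proof induction
      case empty
      show ?case by (intro exI[of _ "\<lambda>_. 1"]) auto
    next
      case (insert a Z)
      then obtain W where W: "W holomorphic_on UNIV" "\<And>z. W z = 0 \<longleftrightarrow> z \<in> Z" "\<And>a. a\<in>Z \<Longrightarrow> deriv W a \<noteq> 0"
        by blast
      have df: "W field_differentiable at z" for z using W(1) by (simp add: holomorphic_on_def)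
      have deriv: "deriv (\<lambda>z. (z - a) * W z) z = (z - a) * deriv W z + W z" for z
        using df[of z] by (subst deriv_mult) (auto intro!: derivative_intros)
      show ?case
      proof (intro exI[of _ "\<lambda>z. (z - a) * W z"] conjI allI ballI)
        fix z assume z: "z \<in> insert a Z"
        show "deriv (\<lambda>z. (z - a) * W z) z \<noteq> 0"
        proof (cases "z = a")
          case True
          then show ?thesis using W(2) insert.hyps by (simp add: deriv)
        next
          case False
          then have "W z = 0" "deriv W z \<noteq> 0" using z W(2,3) by auto
          then show ?thesis using False by (simp add: deriv)
        qed
      qed (use W in \<open>auto intro!: holomorphic_intros\<close>)
    qed
  next
    case False
    have "closed Z"
      unfolding closed_limpt
    proof (intro allI impI)
      fix z assume "z islimpt Z"
      then have "infinite (Z \<inter> ball z 1)" by (auto simp: islimpt_eq_infinite_ball)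
      moreover have "Z \<inter> ball z 1 \<subseteq> Z \<inter> cball 0 (cmod z + 1)"
      proof
        fix x assume "x \<in> Z \<inter> ball z 1"
        then show "x \<in> Z \<inter> cball 0 (cmod z + 1)"
          using norm_triangle_sub[of x z] by (simp add: dist_norm norm_minus_commute)
      qed
      ultimately show "z \<in> Z" using fin finite_subset by blast
    qed
    then obtain a :: "nat \<Rightarrow> complex" where a: "inj a" "range a = Z" "filterlim a at_infinity at_top"
      using sequence_of_sparse_set_exists[OF False _ fin] by metis
    interpret WP: weierstrass_product' a
      by unfold_locales (use a Z0 in \<open>auto intro!: finite_vimageI\<close>)
    have "deriv WP.f z \<noteq> 0" if "z \<in> Z" for z
    proof -
      obtain k where k: "a k = z" using a(2) \<open>z \<in> Z\<close> by blast
      have "a -` {z} = {k}" using a(1) k by (auto simp: inj_def)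
      then have ord: "zorder WP.f z = 1" by (simp add: WP.zorder)
      obtain w where "w \<notin> Z"
        using Z0 by blast
      then have "\<exists>w\<in>UNIV. WP.f w \<noteq> 0" by (auto simp: WP.zero a(2))
      then obtain r where r: "r > 0" "zor_poly WP.f z holomorphic_on cball z r"
          "\<And>w. w \<in> cball z r \<Longrightarrow> WP.f w = zor_poly WP.f z w * (w - z)"
          "\<And>w. w \<in> cball z r \<Longrightarrow> zor_poly WP.f z w \<noteq> 0"
        using zorder_exist_zero[OF WP.holomorphic open_UNIV connected_UNIV UNIV_I[of z]] ord
        by auto
      have "zor_poly WP.f z field_differentiable at z"
        using r(1) holomorphic_on_imp_differentiable_at[OF holomorphic_on_subset[OF r(2) ball_subset_cball]]
        by simp
      then have "deriv (\<lambda>w. zor_poly WP.f z w * (w - z)) z = zor_poly WP.f z z"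
        by (subst deriv_mult) (auto intro!: derivative_intros)
      moreover have "\<forall>\<^sub>F w in nhds z. WP.f w = zor_poly WP.f z w * (w - z)"
        using eventually_nhds_ball[OF r(1), of z] by eventually_elim (simp add: r(3))
      ultimately have "deriv WP.f z = zor_poly WP.f z z"
        using deriv_cong_ev by metis
      then show ?thesis using r by simp
    qed
    then show ?thesis
      by (intro exI[of _ WP.f]) (simp add: WP.holomorphic WP.zero a(2))
  qed
  have "infinite (cball (0::complex) 1)"
    using uncountable_cball[of 1 "0::complex"] countable_finite by auto
  then have "\<not> cball 0 1 \<subseteq> Z"
    using fin[of 1] by (auto simp: Int_absorb1)
  then obtain c where c: "c \<notin> Z" by blast
  let ?Z = "(\<lambda>z. z - c) ` Z"
  have Z0: "0 \<notin> ?Z" using c by auto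
  have Zfin: "finite (?Z \<inter> cball 0 r)" for r
  proof (rule finite_subset)
    show "?Z \<inter> cball 0 r \<subseteq> (\<lambda>z. z - c) ` (Z \<inter> cball 0 (r + cmod c))"
    proof
      fix x assume "x \<in> ?Z \<inter> cball 0 r"
      then obtain z where "z \<in> Z" "x = z - c" "cmod x \<le> r" by auto
      then show "x \<in> (\<lambda>z. z - c) ` (Z \<inter> cball 0 (r + cmod c))"
        using norm_triangle_sub[of z c] by auto
    qed
  qed (use fin in auto)
  obtain W where "W holomorphic_on UNIV \<and> (\<forall>z. W z = 0 \<longleftrightarrow> z \<in> ?Z) \<and> (\<forall>a\<in>?Z. deriv W a \<noteq> 0)"
    using main[OF Z0 Zfin] ..
  then have W: "W holomorphic_on UNIV" "\<And>z. W z = 0 \<longleftrightarrow> z \<in> ?Z" "\<And>a. a \<in> ?Z \<Longrightarrow> deriv W a \<noteq> 0"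
    by auto
  have df: "(W has_field_derivative deriv W z) (at z)" for z
    using W(1) by (simp add: holomorphic_derivI)
  have dW: "((\<lambda>z. W (z - c)) has_field_derivative deriv W (z - c)) (at z)" for z
    using DERIV_chain2[OF df, of "\<lambda>z. z - c" 1 z UNIV] by (simp add: DERIV_diff[where E=0, simplified])
  show thesis
  proof (rule that[of "\<lambda>z. W (z - c)"])
    show "(\<lambda>z. W (z - c)) holomorphic_on UNIV"
      using dW by (auto simp: holomorphic_on_def field_differentiable_def)
    show "W (z - c) = 0 \<longleftrightarrow> z \<in> Z" for z using W(2) by auto
    show "deriv (\<lambda>z. W (z - c)) a \<noteq> 0" if "a \<in> Z" for a
      using DERIV_imp_deriv[OF dW, of a] W(3) that by auto
  qed
qed

section \<open>The spherical derivative and homogeneous coordinates\<close>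

text \<open>
  The Wronskians of \<open>u * v\<close> are $u^2$ times those of \<open>v\<close>, and so a common factor cancels from the
  spherical derivative. It can therefore be estimated from any local representation, however
  large or small the global one is.
\<close>

lemma spherical_formula_le:
  assumes u: "u field_differentiable at z" "u z \<noteq> 0"
    and v: "\<And>j. j \<le> n \<Longrightarrow> v j field_differentiable at z"
    and f: "\<And>j. j \<le> n \<Longrightarrow> \<forall>\<^sub>F w in nhds z. f j w = u w * v j w"
    and M: "\<And>j. j \<le> n \<Longrightarrow> cmod (v j z) \<le> M" "\<And>j. j \<le> n \<Longrightarrow> cmod (deriv (v j) z) \<le> M"
    and \<delta>: "0 < \<delta>" "k \<le> n" "\<delta> \<le> cmod (v k z)"
  shows "spherical_formula n f z \<le> 2 * real (n + 1) * M\<^sup>2 / \<delta>\<^sup>2"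
proof -
  let ?P = "{(i, j). i < j \<and> j \<le> n}"
  have M0: "0 \<le> M" using M(1)[of 0] norm_ge_zero order_trans by blast
  have fz: "f j z = u z * v j z" if "j \<le> n" for j
    using eventually_nhds_x_imp_x[OF f[OF that]] .
  have df: "deriv (f j) z = u z * deriv (v j) z + deriv u z * v j z" if "j \<le> n" for j
    using deriv_cong_ev[OF f[OF that] refl] deriv_mult[OF u(1) v[OF that]] by simp
  have W: "(cmod (deriv (f i) z * f j z - f i z * deriv (f j) z))\<^sup>2 \<le> (cmod (u z))^4 * (2 * M\<^sup>2)\<^sup>2"
    if "i \<le> n" "j \<le> n" for i j
  proof -
    have eq: "deriv (f i) z * f j z - f i z * deriv (f j) z
        = (u z)\<^sup>2 * (deriv (v i) z * v j z - v i z * deriv (v j) z)"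
      using that by (simp add: fz df power2_eq_square algebra_simps)
    have "cmod (deriv (v i) z * v j z) \<le> M * M" "cmod (v i z * deriv (v j) z) \<le> M * M"
      unfolding norm_mult using that M M0 by (intro mult_mono; simp)+
    then have "cmod (deriv (v i) z * v j z - v i z * deriv (v j) z) \<le> 2 * M\<^sup>2"
      using norm_triangle_ineq4[of "deriv (v i) z * v j z" "v i z * deriv (v j) z"]
      by (simp add: power2_eq_square)
    then have "(cmod (deriv (v i) z * v j z - v i z * deriv (v j) z))\<^sup>2 \<le> (2 * M\<^sup>2)\<^sup>2"
      by (rule power_mono) simp
    then show ?thesis
      unfolding eq norm_mult norm_power power_mult_distrib
      by (intro mult_mono) (auto simp flip: power_mult)
  qed
  have fin: "?P \<subseteq> {..n} \<times> {..n}" by auto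
  then have card: "card ?P \<le> (n + 1) * (n + 1)"
    using card_mono[of "{..n} \<times> {..n}" ?P] by simp
  have "(\<Sum>(i, j)\<in>?P. (cmod (deriv (f i) z * f j z - f i z * deriv (f j) z))\<^sup>2)
      \<le> real (card ?P) * ((cmod (u z))^4 * (2 * M\<^sup>2)\<^sup>2)"
    by (rule sum_bounded_above, clarify, rule W) auto
  also have "\<dots> \<le> real ((n + 1) * (n + 1)) * ((cmod (u z))^4 * (2 * M\<^sup>2)\<^sup>2)"
    using card by (intro mult_right_mono) (auto simp del: of_nat_mult of_nat_add)
  also have "\<dots> = (2 * real (n + 1) * M\<^sup>2)\<^sup>2 * (cmod (u z))^4"
    by (simp add: power2_eq_square algebra_simps)
  finally have num: "(\<Sum>(i, j)\<in>?P. (cmod (deriv (f i) z * f j z - f i z * deriv (f j) z))\<^sup>2)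
      \<le> (2 * real (n + 1) * M\<^sup>2)\<^sup>2 * (cmod (u z))^4" .
  have "(\<delta> * cmod (u z))\<^sup>2 \<le> (cmod (f k z))\<^sup>2"
    unfolding fz[OF \<delta>(2)] norm_mult mult.commute[of \<delta>]
    using \<delta> by (intro power_mono mult_left_mono) auto
  also have "\<dots> \<le> (\<Sum>j\<le>n. (cmod (f j z))\<^sup>2)"
    using \<delta>(2) by (intro member_le_sum) auto
  finally have den: "((\<delta> * cmod (u z))\<^sup>2)\<^sup>2 \<le> (\<Sum>j\<le>n. (cmod (f j z))\<^sup>2)\<^sup>2"
    by (intro power_mono) auto
  have "(\<Sum>(i, j)\<in>?P. (cmod (deriv (f i) z * f j z - f i z * deriv (f j) z))\<^sup>2) / (\<Sum>j\<le>n. (cmod (f j z))\<^sup>2)\<^sup>2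
      \<le> ((2 * real (n + 1) * M\<^sup>2)\<^sup>2 * (cmod (u z))^4) / ((\<delta> * cmod (u z))\<^sup>2)\<^sup>2"
    using num den \<delta>(1) u(2) by (intro frac_le) auto
  also have "\<dots> = (2 * real (n + 1) * M\<^sup>2 / \<delta>\<^sup>2)\<^sup>2"
    using u(2) \<delta>(1) by (simp add: power_mult_distrib power_divide flip: power_mult)
  finally have "spherical_formula n f z \<le> sqrt ((2 * real (n + 1) * M\<^sup>2 / \<delta>\<^sup>2)\<^sup>2)"
    unfolding spherical_formula_def by (rule real_sqrt_le_mono)
  then show ?thesis by simp
qed

lemma spherical_formula_rescale:
  assumes f: "\<And>j. j \<le> n \<Longrightarrow> f j holomorphic_on UNIV" and c: "0 < c"
  shows "spherical_formula n (\<lambda>j z. f j (of_real c * z)) z = c * spherical_formula n f (of_real c * z)"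
proof -
  let ?P = "{(i, j). i < j \<and> j \<le> n}"
  have d: "deriv (\<lambda>z. f j (of_real c * z)) z = of_real c * deriv (f j) (of_real c * z)" if "j \<le> n" for j
  proof -
    have "(f j has_field_derivative deriv (f j) (of_real c * z)) (at (of_real c * z))"
      using f[OF that] by (simp add: holomorphic_derivI)
    then have "((\<lambda>z. f j (of_real c * z)) has_field_derivative deriv (f j) (of_real c * z) * of_real c) (at z)"
      by (rule DERIV_chain2) (auto intro!: derivative_eq_intros)
    then show ?thesis by (simp add: DERIV_imp_deriv mult.commute)
  qed
  have "(\<Sum>(i, j)\<in>?P. (cmod (deriv (\<lambda>z. f i (of_real c * z)) z * f j (of_real c * z)
        - f i (of_real c * z) * deriv (\<lambda>z. f j (of_real c * z)) z))\<^sup>2)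
      = (\<Sum>(i, j)\<in>?P. c\<^sup>2 * (cmod (deriv (f i) (of_real c * z) * f j (of_real c * z)
        - f i (of_real c * z) * deriv (f j) (of_real c * z)))\<^sup>2)"
  proof (intro sum.cong refl, clarify)
    fix i j assume "i < j" "j \<le> n"
    then have ij: "i \<le> n" "j \<le> n" by auto
    have "deriv (\<lambda>z. f i (of_real c * z)) z * f j (of_real c * z)
        - f i (of_real c * z) * deriv (\<lambda>z. f j (of_real c * z)) z
      = of_real c * (deriv (f i) (of_real c * z) * f j (of_real c * z)
        - f i (of_real c * z) * deriv (f j) (of_real c * z))"
      unfolding d[OF ij(1)] d[OF ij(2)] by (simp add: algebra_simps)
    then show "(cmod (deriv (\<lambda>z. f i (of_real c * z)) z * f j (of_real c * z)
        - f i (of_real c * z) * deriv (\<lambda>z. f j (of_real c * z)) z))\<^sup>2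
      = c\<^sup>2 * (cmod (deriv (f i) (of_real c * z) * f j (of_real c * z)
        - f i (of_real c * z) * deriv (f j) (of_real c * z)))\<^sup>2"
      by (simp only: norm_mult power_mult_distrib) simp
  qed
  also have "\<dots> = c\<^sup>2 * (\<Sum>(i, j)\<in>?P. (cmod (deriv (f i) (of_real c * z) * f j (of_real c * z)
        - f i (of_real c * z) * deriv (f j) (of_real c * z)))\<^sup>2)"
    by (simp add: sum_distrib_left case_prod_unfold)
  finally show ?thesis
    unfolding spherical_formula_def using c
    by (simp add: real_sqrt_mult flip: times_divide_eq_right)
qed

lemma proj_point_scale:
  assumes "c \<noteq> 0" and y: "\<And>j. j \<le> n \<Longrightarrow> y j = c * x j" and x: "\<exists>j\<le>n. x j \<noteq> 0"
  shows "proj_point n y = proj_point n x"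
proof -
  have y0: "\<exists>j\<le>n. y j \<noteq> 0" using assms by auto
  have "(\<lambda>i. if i \<le> n then y i else 0) = (\<lambda>i. if i \<le> n then c * x i else 0)"
    using y by auto
  then have "(\<lambda>i. if i \<le> n then y i else 0) \<in> proj_point n x"
    unfolding mem_proj_point[OF x] using assms(1) by metis
  then have "((\<lambda>i. if i \<le> n then x i else 0), (\<lambda>i. if i \<le> n then y i else 0)) \<in> proportional n"
    by (simp add: proj_point_def)
  then show ?thesis
    unfolding proj_point_def using equiv_class_eq[OF equiv_proportional] by metis
qed

text \<open>
  Division by a coordinate of largest modulus.
\<close>

lemma normalized_coordinates:
  assumes "p \<in> proj_space n"
  obtains \<beta> where "\<And>j. j \<le> n \<Longrightarrow> cmod (\<beta> j) \<le> 1" "p = proj_point n \<beta>"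
    "\<beta> 0 = 1 \<or> (\<exists>j\<in>{1..n}. cmod (\<beta> j) = 1)"
proof -
  obtain x where x: "x \<in> nonzero_vectors n" "p = proportional n `` {x}"
    using assms unfolding proj_space_def by (elim quotientE)
  have x': "(\<lambda>i. if i \<le> n then x i else 0) = x" and nz: "\<exists>j\<le>n. x j \<noteq> 0"
    using x(1) by (auto simp: nonzero_vectors_def)
  have p: "p = proj_point n x" unfolding proj_point_def x' by (rule x(2))
  have fin: "finite ((\<lambda>j. cmod (x j)) ` {..n})" "(\<lambda>j. cmod (x j)) ` {..n} \<noteq> {}" by auto
  then obtain k where k: "k \<le> n" "Max ((\<lambda>j. cmod (x j)) ` {..n}) = cmod (x k)"
    using Max_in by (metis (mono_tags, lifting) atMost_iff imageE)
  have max: "cmod (x j) \<le> cmod (x k)" if "j \<le> n" for j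
    using Max_ge[OF fin(1)] that k(2) by auto
  have xk: "x k \<noteq> 0" using nz max by force
  show thesis
  proof (rule that[of "\<lambda>j. x j / x k"])
    show "cmod (x j / x k) \<le> 1" if "j \<le> n" for j
      using max[OF that] xk by (simp add: norm_divide divide_le_eq)
    show "p = proj_point n (\<lambda>j. x j / x k)"
      unfolding p by (rule proj_point_scale[of "x k"]) (use xk k(1) in auto)
    show "x 0 / x k = 1 \<or> (\<exists>j\<in>{1..n}. cmod (x j / x k) = 1)"
      using k(1) xk by (cases "k = 0") (auto intro!: bexI[of _ k] simp: norm_divide)
  qed
qed

section \<open>Polar sums over a separated set\<close>

text \<open>
  The numerator is the affine function of \<open>z\<close> with value \<open>p m\<close> and slope \<open>s m\<close> at the node \<open>m\<close>;
  the only pole is \<open>a m\<close>, which will lie within distance 1 of \<open>m\<close>. The fifth power leaves a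
  decay of order 4 even when the slope does not vanish.
\<close>

definition polar_term ::
    "(complex \<Rightarrow> complex) \<Rightarrow> (complex \<Rightarrow> complex) \<Rightarrow> (complex \<Rightarrow> complex) \<Rightarrow> complex \<Rightarrow> complex \<Rightarrow> complex" where
  "polar_term a s p m z = (p m + s m * (z - m)) / (a m - z) ^ 5"

text \<open>
  Sparse sets whose separation is so large that the tails in \<open>tail\<close> are tiny. The number 640
  is chosen for terms bounded by $160/|m-z|^4$: their tails are then at most $1/4$.
\<close>

locale separated_set =
  fixes R :: real and E :: "complex set"
  assumes R_ge: "8 \<le> R" and sparse: "sparse_set R E"
    and tail: "\<And>D z. \<lbrakk>D \<subseteq> E; \<And>m. m \<in> D \<Longrightarrow> R / 2 \<le> cmod (m - z)\<rbrakk> \<Longrightarrow>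
       (\<lambda>m. 1 / cmod (m - z) ^ 4) summable_on D \<and> (\<Sum>\<^sub>\<infinity>m\<in>D. 1 / cmod (m - z) ^ 4) \<le> 1 / 640"

lemma separation_radius_exists:
  obtains R :: real where "8 \<le> R" "\<And>E. sparse_set R E \<Longrightarrow> separated_set R E"
proof -
  obtain C :: real where C: "C > 0"
    "\<And>R E z. \<lbrakk>0 < R; sparse_set R E; \<And>m. m \<in> E \<Longrightarrow> R / 2 \<le> cmod (m - z)\<rbrakk> \<Longrightarrow>
       (\<lambda>m. 1 / cmod (m - z) ^ 4) summable_on E \<and>
       (\<Sum>\<^sub>\<infinity>m\<in>E. 1 / cmod (m - z) ^ 4) \<le> C / R ^ 4"
    using sparse_set_sum_bound by metis
  \<comment> \<open>Since \<open>R \<ge> 1\<close>, also \<open>R ^ 4 \<ge> R \<ge> 640 * C\<close>.\<close>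
  define R where "R = 640 * C + 8"
  have R: "8 \<le> R" "640 * C \<le> R" using C(1) by (auto simp: R_def)
  have "R * 1 \<le> R * R ^ 3" using R by (intro mult_left_mono one_le_power) auto
  then have "640 * C \<le> R ^ 4" using R(2) by (simp add: eval_nat_numeral)
  then have small: "C / R ^ 4 \<le> 1 / 640" using R(1) by (simp add: field_simps)
  show thesis
  proof (rule that[OF R(1)])
    fix E assume sp: "sparse_set R E"
    show "separated_set R E"
    proof
      fix D z assume D: "D \<subseteq> E" "\<And>m. m \<in> D \<Longrightarrow> R / 2 \<le> cmod (m - z)"
      have "sparse_set R D" using sp D(1) by (auto simp: sparse_set_def)
      then have "(\<lambda>m. 1 / cmod (m - z) ^ 4) summable_on D \<and> (\<Sum>\<^sub>\<infinity>m\<in>D. 1 / cmod (m - z) ^ 4) \<le> C / R ^ 4"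
        using R(1) D(2) by (intro C(2)) auto
      then show "(\<lambda>m. 1 / cmod (m - z) ^ 4) summable_on D \<and> (\<Sum>\<^sub>\<infinity>m\<in>D. 1 / cmod (m - z) ^ 4) \<le> 1 / 640"
        using small by linarith
    qed (use R sp in auto)
  qed
qed

context separated_set
begin

text \<open>
  A family of functions attached to the points of \<open>E\<close>, holomorphic away from their own point and with
  enough decay there for their sum over \<open>E\<close> to converge locally uniformly.
\<close>

definition decaying :: "real \<Rightarrow> (complex \<Rightarrow> complex \<Rightarrow> complex) \<Rightarrow> bool" where
  "decaying A T \<longleftrightarrow> (\<forall>m\<in>E. T m holomorphic_on {z. 2 < cmod (m - z)} \<and>
     (\<forall>z. 2 \<le> cmod (m - z) \<longrightarrow> cmod (T m z) \<le> A / cmod (m - z) ^ 4))"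

lemma decaying_nonneg:
  assumes "decaying A T" "m \<in> E"
  shows "0 \<le> A"
proof -
  have "cmod (m - (m + 2)) = 2" by simp
  then have "cmod (T m (m + 2)) \<le> A / 2 ^ 4"
    using assms unfolding decaying_def by (metis order_refl)
  then have "0 \<le> A / 2 ^ 4"
    using norm_ge_zero order_trans by blast
  then show ?thesis by simp
qed

lemma close_unique:
  assumes "m \<in> E" "m' \<in> E" "cmod (m - z) < R / 2" "cmod (m' - z) < R / 2"
  shows "m = m'"
proof (rule ccontr)
  assume "m \<noteq> m'"
  then have "R \<le> dist m m'" using sparse assms by (auto simp: sparse_set_def)
  moreover have "dist m m' \<le> cmod (m - z) + cmod (m' - z)"
    using dist_triangle2[of m m' z] by (simp add: dist_norm)
  ultimately show False using assms by simp
qed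

lemma far_of_close:
  assumes "m \<in> E" "m' \<in> E" "m \<noteq> m'" "cmod (m - z) < R / 2"
  shows "R / 2 \<le> cmod (m' - z)"
  using close_unique assms not_le by blast

text \<open>
  At most one point of \<open>E\<close> is closer to \<open>z\<close> than \<open>R / 2\<close>, and the others are controlled by the tail
  bound.
\<close>

lemma inverse_fourth_summable:
  assumes "D \<subseteq> E"
  shows "(\<lambda>m. 1 / cmod (m - z) ^ 4) summable_on D"
proof -
  let ?N = "{m\<in>D. cmod (m - z) < R / 2}"
  have "finite ?N"
  proof (cases "?N = {}")
    case True
    show ?thesis unfolding True by simp
  next
    case False
    then obtain m where "m \<in> ?N" by blast
    then have "?N \<subseteq> {m}" using close_unique assms by blast
    then show ?thesis using finite_subset by blast
  qed
  then have "(\<lambda>m. 1 / cmod (m - z) ^ 4) summable_on ({m\<in>D. R / 2 \<le> cmod (m - z)} \<union> ?N)"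
    using tail[of "{m\<in>D. R / 2 \<le> cmod (m - z)}" z] assms
    by (intro summable_on_Un_disjoint) auto
  also have "{m\<in>D. R / 2 \<le> cmod (m - z)} \<union> ?N = D" by auto
  finally show ?thesis .
qed

lemma decaying_summable:
  assumes T: "decaying A T" and D: "D \<subseteq> E" and z: "\<And>m. m \<in> D \<Longrightarrow> 2 \<le> cmod (m - z)"
  shows "(\<lambda>m. T m z) summable_on D"
proof (rule abs_summable_summable[OF Infinite_Sum.abs_summable_on_comparison_test'])
  show "(\<lambda>m. A * (1 / cmod (m - z) ^ 4)) summable_on D"
    by (intro summable_on_cmult_right inverse_fourth_summable D)
  show "norm (T m z) \<le> A * (1 / cmod (m - z) ^ 4)" if "m \<in> D" for m
    using T D z that by (auto simp: decaying_def)
qed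

lemma decaying_infsum_le:
  assumes T: "decaying A T" and D: "D \<subseteq> E" and z: "\<And>m. m \<in> D \<Longrightarrow> R / 2 \<le> cmod (m - z)" and "0 \<le> A"
  shows "cmod (\<Sum>\<^sub>\<infinity>m\<in>D. T m z) \<le> A / 640"
proof -
  have le: "norm (T m z) \<le> A * (1 / cmod (m - z) ^ 4)" if "m \<in> D" for m
    using T D z[OF that] R_ge that by (auto simp: decaying_def)
  have "2 \<le> cmod (m - z)" if "m \<in> D" for m using z[OF that] R_ge by simp
  then have "cmod (\<Sum>\<^sub>\<infinity>m\<in>D. T m z) \<le> (\<Sum>\<^sub>\<infinity>m\<in>D. A * (1 / cmod (m - z) ^ 4))"
    by (intro norm_infsum_le[OF has_sum_infsum has_sum_infsum] decaying_summable[OF T D]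
        summable_on_cmult_right inverse_fourth_summable D le)
  also have "\<dots> = A * (\<Sum>\<^sub>\<infinity>m\<in>D. 1 / cmod (m - z) ^ 4)"
    by (rule infsum_cmult_right) (use inverse_fourth_summable[OF D] in auto)
  also have "\<dots> \<le> A * (1 / 640)"
    using tail[OF D z] \<open>0 \<le> A\<close> by (intro mult_left_mono) auto
  finally show ?thesis by simp
qed

text \<open>
  The Weierstrass test on a disc of radius at most 1 about \<open>z0\<close>. There \<open>cmod (m - z)\<close> is at least
  half of \<open>cmod (m - z0)\<close>, and this gives a majorant independent of \<open>z\<close> at the price of a factor 16.
\<close>

lemma decaying_infsum_holomorphic:
  assumes T: "decaying A T" and D: "D \<subseteq> E" and "open G"
    and G: "\<And>m z. \<lbrakk>m \<in> D; z \<in> G\<rbrakk> \<Longrightarrow> 2 < cmod (m - z)"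
  shows "(\<lambda>z. \<Sum>\<^sub>\<infinity>m\<in>D. T m z) holomorphic_on G"
proof -
  have "(\<lambda>z. \<Sum>\<^sub>\<infinity>m\<in>D. T m z) field_differentiable at z0" if "z0 \<in> G" for z0
  proof -
    obtain r0 where r0: "r0 > 0" "cball z0 r0 \<subseteq> G"
      using \<open>open G\<close> \<open>z0 \<in> G\<close> by (meson open_contains_cball)
    define r where "r = min r0 1"
    have r: "r > 0" "r \<le> 1" and rG: "cball z0 r \<subseteq> G"
      using r0 by (auto simp: r_def)
    have hol: "T m holomorphic_on G" if m: "m \<in> D" for m
    proof (rule holomorphic_on_subset)
      show "T m holomorphic_on {z. 2 < cmod (m - z)}"
        using T D m unfolding decaying_def by blast
      show "G \<subseteq> {z. 2 < cmod (m - z)}" using G[OF m] by blast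
    qed
    have ulim: "uniform_limit (cball z0 r) (\<lambda>X z. \<Sum>m\<in>X. T m z) (\<lambda>z. \<Sum>\<^sub>\<infinity>m\<in>D. T m z) (finite_subsets_at_top D)"
    proof (rule Weierstrass_m_test_general)
      show "(\<lambda>m. 16 * A * (1 / cmod (m - z0) ^ 4)) summable_on D"
        by (intro summable_on_cmult_right inverse_fourth_summable D)
      fix m z assume m: "m \<in> D" and z: "z \<in> cball z0 r"
      have A: "0 \<le> A" using decaying_nonneg[OF T] m D by blast
      have "cmod (m - z0) \<le> cmod (m - z) + 1"
        using dist_triangle[of m z0 z] z r by (simp add: dist_norm norm_minus_commute)
      moreover have z2: "2 < cmod (m - z)" using G[of m z] m z rG by auto
      ultimately have half: "cmod (m - z0) / 2 \<le> cmod (m - z)" by simp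
      have z02: "2 < cmod (m - z0)" using G m that by auto
      have "norm (T m z) \<le> A / cmod (m - z) ^ 4"
        using T D m z2 by (auto simp: decaying_def)
      also have "\<dots> \<le> A / (cmod (m - z0) / 2) ^ 4"
        using half z2 z02 A by (intro divide_left_mono power_mono mult_pos_pos) auto
      finally show "norm (T m z) \<le> 16 * A * (1 / cmod (m - z0) ^ 4)"
        by (simp add: power_divide mult.commute)
    qed
    have cont: "\<forall>\<^sub>F X in finite_subsets_at_top D. continuous_on (cball z0 r) (\<lambda>z. \<Sum>m\<in>X. T m z)
        \<and> (\<lambda>z. \<Sum>m\<in>X. T m z) holomorphic_on ball z0 r"
    proof (rule eventually_mono[OF eventually_finite_subsets_at_top_weakI])
      fix X assume X: "finite X" "X \<subseteq> D"
      have "(\<lambda>z. \<Sum>m\<in>X. T m z) holomorphic_on G"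
        using X hol by (intro holomorphic_intros) auto
      then have "(\<lambda>z. \<Sum>m\<in>X. T m z) holomorphic_on cball z0 r"
        using rG by (rule holomorphic_on_subset)
      then show "continuous_on (cball z0 r) (\<lambda>z. \<Sum>m\<in>X. T m z)
        \<and> (\<lambda>z. \<Sum>m\<in>X. T m z) holomorphic_on ball z0 r"
        by (auto intro: holomorphic_on_imp_continuous_on holomorphic_on_subset)
    qed auto
    have "(\<lambda>z. \<Sum>\<^sub>\<infinity>m\<in>D. T m z) holomorphic_on ball z0 r"
      by (rule holomorphic_uniform_limit[OF cont ulim finite_subsets_at_top_neq_bot])
    then show ?thesis
      using r by (intro holomorphic_on_imp_differentiable_at[of _ "ball z0 r"]) auto
  qed
  then show ?thesis
    by (auto simp: holomorphic_on_def intro: field_differentiable_at_within)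
qed

lemma polar_term_decaying:
  assumes a: "\<And>m. m \<in> E \<Longrightarrow> cmod (a m - m) \<le> 1"
    and p: "\<And>m. m \<in> E \<Longrightarrow> cmod (p m) \<le> B" and s: "\<And>m. m \<in> E \<Longrightarrow> cmod (s m) \<le> S"
  shows "decaying (16 * B + 32 * S) (polar_term a s p)"
  unfolding decaying_def
proof (intro ballI conjI allI impI)
  fix m assume m: "m \<in> E"
  have az: "cmod (m - z) / 2 \<le> cmod (a m - z)" if "2 \<le> cmod (m - z)" for z
  proof -
    have "cmod (m - z) \<le> cmod (a m - z) + cmod (a m - m)"
      using dist_triangle[of m z "a m"] by (simp add: dist_norm norm_minus_commute)
    then show ?thesis using a[OF m] that by linarith
  qed
  show "polar_term a s p m holomorphic_on {z. 2 < cmod (m - z)}"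
  proof -
    have "a m - z \<noteq> 0" if "2 < cmod (m - z)" for z
      using az[of z] that by fastforce
    then show ?thesis
      unfolding polar_term_def by (intro holomorphic_intros) simp
  qed
  fix z assume z: "2 \<le> cmod (m - z)"
  have pos: "0 < cmod (m - z)" using z by linarith
  have B: "0 \<le> B" using p[OF m] norm_ge_zero order_trans by blast
  have "cmod (p m + s m * (z - m)) \<le> B + S * cmod (m - z)"
    using p[OF m] s[OF m] norm_triangle_ineq[of "p m" "s m * (z - m)"]
      mult_right_mono[OF s[OF m], of "cmod (m - z)"] by (simp add: norm_mult norm_minus_commute)
  also have "\<dots> \<le> (B / 2 + S) * cmod (m - z)"
    using mult_left_mono[OF z, of "B / 2"] B by (simp add: algebra_simps)
  finally have num: "cmod (p m + s m * (z - m)) \<le> (B / 2 + S) * cmod (m - z)" .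
  have "cmod (polar_term a s p m z) \<le> ((B / 2 + S) * cmod (m - z)) / (cmod (m - z) / 2) ^ 5"
    unfolding polar_term_def norm_divide norm_power
    using num az[OF z] pos order_trans[OF norm_ge_zero num] by (intro frac_le power_mono) auto
  also have "\<dots> = (16 * B + 32 * S) / cmod (m - z) ^ 4"
    using pos by (simp add: field_simps eval_nat_numeral)
  finally show "cmod (polar_term a s p m z) \<le> (16 * B + 32 * S) / cmod (m - z) ^ 4" .
qed

text \<open>
  The values of the numerators at the nodes must make up for the contributions of all other nodes.
  This is a linear system in \<open>p\<close>, since the poles and the slopes are prescribed, and the wide
  separation makes its off-diagonal part a contraction.
\<close>

lemma interpolation_fixpoint:
  assumes a: "\<And>m. m \<in> E \<Longrightarrow> cmod (a m - m) \<le> 1"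
    and s: "\<And>m. m \<in> E \<Longrightarrow> cmod (s m) \<le> 4"
    and u: "\<And>m. m \<in> E \<Longrightarrow> cmod (u m) \<le> 1" and v: "\<And>m. m \<in> E \<Longrightarrow> cmod (v m) \<le> 1"
  obtains p where "\<And>m. m \<in> E \<Longrightarrow> cmod (p m) \<le> 2"
    "\<And>m. m \<in> E \<Longrightarrow> p m + u m * (\<Sum>\<^sub>\<infinity>k\<in>E - {m}. polar_term a s p k m) = v m"
proof -
  define T where "T = (\<lambda>p m. v m - u m * (\<Sum>\<^sub>\<infinity>k\<in>E - {m}. polar_term a s p k m))"
  have far: "R / 2 \<le> cmod (k - m)" if "k \<in> E - {m}" "m \<in> E" for k m
    using far_of_close[of m k m] that R_ge by auto
  show thesis
  proof (rule bounded_contraction_fixpoint[of 2 "1 / 2" E T])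
    fix p m assume p: "\<And>y. y \<in> E \<Longrightarrow> cmod (p y) \<le> 2" and m: "m \<in> E"
    have "cmod (\<Sum>\<^sub>\<infinity>k\<in>E - {m}. polar_term a s p k m) \<le> (16 * 2 + 32 * 4) / 640"
      by (intro decaying_infsum_le[OF polar_term_decaying] far m) (use a p s in auto)
    then have "cmod (u m * (\<Sum>\<^sub>\<infinity>k\<in>E - {m}. polar_term a s p k m)) \<le> 1 * 1"
      unfolding norm_mult using u[OF m] by (intro mult_mono) auto
    then show "cmod (T p m) \<le> 2"
      unfolding T_def using v[OF m] norm_triangle_ineq4[of "v m"] by (smt (verit))
  next
    fix p q d m
    assume p: "\<And>y. y \<in> E \<Longrightarrow> cmod (p y) \<le> 2" and q: "\<And>y. y \<in> E \<Longrightarrow> cmod (q y) \<le> 2"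
      and d: "\<And>y. y \<in> E \<Longrightarrow> cmod (p y - q y) \<le> d" and m: "m \<in> E"
    have d0: "0 \<le> d" using d[OF m] norm_ge_zero order_trans by blast
    have summ: "(\<lambda>k. polar_term a s p k m) summable_on (E - {m})" if "\<And>y. y \<in> E \<Longrightarrow> cmod (p y) \<le> 2" for p
      by (rule decaying_summable[OF polar_term_decaying[of a p 2 s 4]])
         (use a s that far[OF _ m] R_ge in force)+
    \<comment> \<open>The difference of two polar sums is a polar sum with slopes 0.\<close>
    have "cmod (\<Sum>\<^sub>\<infinity>k\<in>E - {m}. polar_term a (\<lambda>_. 0) (\<lambda>y. p y - q y) k m) \<le> (16 * d + 32 * 0) / 640"
      by (intro decaying_infsum_le[OF polar_term_decaying] far m) (use a d d0 in auto)
    also have "(\<Sum>\<^sub>\<infinity>k\<in>E - {m}. polar_term a (\<lambda>_. 0) (\<lambda>y. p y - q y) k m) =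
        (\<Sum>\<^sub>\<infinity>k\<in>E - {m}. polar_term a s p k m - polar_term a s q k m)"
      by (intro infsum_cong) (simp add: polar_term_def diff_divide_distrib[symmetric])
    also have "\<dots> = (\<Sum>\<^sub>\<infinity>k\<in>E - {m}. polar_term a s p k m) - (\<Sum>\<^sub>\<infinity>k\<in>E - {m}. polar_term a s q k m)"
    proof -
      have p': "(\<lambda>k. polar_term a s p k m) summable_on (E - {m})" by (rule summ) (rule p)
      have q': "(\<lambda>k. polar_term a s q k m) summable_on (E - {m})" by (rule summ) (rule q)
      show ?thesis
        using infsum_add[OF p' iffD2[OF summable_on_uminus q']] by (simp add: infsum_uminus)
    qed
    finally have le: "cmod ((\<Sum>\<^sub>\<infinity>k\<in>E - {m}. polar_term a s q k m) - (\<Sum>\<^sub>\<infinity>k\<in>E - {m}. polar_term a s p k m)) \<le> 1 / 2 * d"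
      using d0 by (simp add: norm_minus_commute)
    have "T p m - T q m = u m * ((\<Sum>\<^sub>\<infinity>k\<in>E - {m}. polar_term a s q k m) - (\<Sum>\<^sub>\<infinity>k\<in>E - {m}. polar_term a s p k m))"
      by (simp add: T_def algebra_simps)
    then show "cmod (T p m - T q m) \<le> 1 / 2 * d"
      using mult_mono[OF u[OF m] le] by (simp add: norm_mult)
  next
    fix p assume "\<And>m. m \<in> E \<Longrightarrow> cmod (p m) \<le> 2" "\<And>m. m \<in> E \<Longrightarrow> T p m = p m"
    then show thesis
      using that[of p] by (simp add: T_def diff_eq_eq)
  qed auto
qed

end

section \<open>The interpolating curve\<close>

lemma deriv_bound_cball:
  assumes "0 < r" and f: "f holomorphic_on S" "cball z r \<subseteq> S"
    and B: "\<And>w. w \<in> cball z r \<Longrightarrow> cmod (f w) \<le> B"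
  shows "cmod (deriv f z) \<le> B / r"
proof -
  have "f holomorphic_on cball z r" using f by (rule holomorphic_on_subset)
  then have "cmod ((deriv ^^ 1) f z) \<le> fact 1 * B / r ^ 1"
    using \<open>0 < r\<close> by (intro Cauchy_inequality B)
       (auto intro: holomorphic_on_imp_continuous_on holomorphic_on_subset simp: dist_norm)
  then show ?thesis by simp
qed

text \<open>
  The value of the bound in \<open>spherical_formula_le\<close> for coordinates and derivatives of modulus at most
  1280 with one coordinate of modulus at least $1/32$.
\<close>

definition curve_bound :: "nat \<Rightarrow> real" where
  "curve_bound n = 2 * real (n + 1) * 1280\<^sup>2 / (1 / 32)\<^sup>2"

text \<open>
  The row \<open>\<beta> m\<close> contains homogeneous coordinates of the point to be taken at \<open>m\<close>. The denominator
  $(a_m-z)^5$ has the value $\beta_{m,0}$ at \<open>m\<close>, and \<open>p_eq\<close> makes the other coordinates come out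
  right. By the dichotomy, the numerators and the denominator do not vanish together: either all
  numerators are constant and one of them has modulus close to 1, or the denominator vanishes only
  at distance 1 from the node, where the slope 4 keeps the numerators away from 0.
\<close>

locale interpolation_data = separated_set +
  fixes n :: nat and \<beta> :: "complex \<Rightarrow> nat \<Rightarrow> complex" and a s :: "complex \<Rightarrow> complex"
    and p :: "nat \<Rightarrow> complex \<Rightarrow> complex" and W :: "complex \<Rightarrow> complex"
  assumes n: "1 \<le> n"
    and beta: "\<And>m j. \<lbrakk>m \<in> E; j \<le> n\<rbrakk> \<Longrightarrow> cmod (\<beta> m j) \<le> 1"
    and a: "\<And>m. m \<in> E \<Longrightarrow> cmod (a m - m) \<le> 1" "\<And>m. m \<in> E \<Longrightarrow> (a m - m) ^ 5 = \<beta> m 0"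
    and dichotomy: "\<And>m. m \<in> E \<Longrightarrow> \<beta> m 0 = 1 \<and> a m = m + 1 \<and> s m = 4 \<or>
      s m = 0 \<and> (\<exists>j\<in>{1..n}. cmod (\<beta> m j) = 1)"
    and p: "\<And>m j. \<lbrakk>m \<in> E; 1 \<le> j; j \<le> n\<rbrakk> \<Longrightarrow> cmod (p j m) \<le> 2"
    and p_eq: "\<And>m j. \<lbrakk>m \<in> E; 1 \<le> j; j \<le> n\<rbrakk> \<Longrightarrow>
      p j m + \<beta> m 0 * (\<Sum>\<^sub>\<infinity>k\<in>E - {m}. polar_term a s (p j) k m) = \<beta> m j"
    and W: "W holomorphic_on UNIV" "\<And>z. W z = 0 \<longleftrightarrow> z \<in> a ` E" "\<And>m. m \<in> E \<Longrightarrow> deriv W (a m) \<noteq> 0"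
begin

definition remainder :: "nat \<Rightarrow> complex \<Rightarrow> complex \<Rightarrow> complex" where
  "remainder j m z = (\<Sum>\<^sub>\<infinity>k\<in>E - {m}. polar_term a s (p j) k z)"

text \<open>
  Near \<open>m\<close>, the curve in affine coordinates multiplied by the denominator of the polar term at \<open>m\<close>.
\<close>

definition local_rep :: "complex \<Rightarrow> nat \<Rightarrow> complex \<Rightarrow> complex" where
  "local_rep m j z = (if j = 0 then (a m - z) ^ 5
     else p j m + s m * (z - m) + remainder j m z * (a m - z) ^ 5)"

definition affine_rep :: "nat \<Rightarrow> complex \<Rightarrow> complex" where
  "affine_rep j z = (if j = 0 then 1 else \<Sum>\<^sub>\<infinity>k\<in>E. polar_term a s (p j) k z)"

text \<open>
  The entire function \<open>W z ^ 5 / (a m - z) ^ 5\<close>, with its removable singularity filled in.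
\<close>

definition cofactor :: "complex \<Rightarrow> complex \<Rightarrow> complex" where
  "cofactor m z = - ((if z = a m then deriv W (a m) else W z / (z - a m)) ^ 5)"

text \<open>
  Homogeneous coordinates on the whole plane: \<open>W z ^ 5\<close> clears the poles of the affine coordinates.
  At the poles the product is replaced by its limit, which the local representation provides.
\<close>

definition lift :: "nat \<Rightarrow> complex \<Rightarrow> complex" where
  "lift j z = (if z \<in> a ` E then cofactor (inv_into E a z) z * local_rep (inv_into E a z) j z
     else W z ^ 5 * affine_rep j z)"

lemma s_bound: "m \<in> E \<Longrightarrow> cmod (s m) \<le> 4"
  using dichotomy[of m] by auto

lemma decaying: "1 \<le> j \<Longrightarrow> j \<le> n \<Longrightarrow> decaying 160 (polar_term a s (p j))"
  using polar_term_decaying[of a "p j" 2 s 4] a(1) p s_bound by simp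

lemma node_unique:
  assumes "k \<in> E" "m \<in> E" "cmod (m - a k) < R / 2"
  shows "k = m"
  using close_unique[of k m "a k"] assms a(1)[of k] R_ge by (simp add: norm_minus_commute)

lemma zero_in_disc:
  assumes "m \<in> E" "cmod (m - z) < R / 2"
  shows "W z = 0 \<longleftrightarrow> z = a m"
  using node_unique[OF _ assms(1)] assms W(2) by auto

lemma inj_on_nodes: "inj_on a E"
proof (rule inj_onI)
  fix x y assume xy: "x \<in> E" "y \<in> E" "a x = a y"
  then have "cmod (y - a x) < R / 2" using a(1)[of y] R_ge by (simp add: norm_minus_commute)
  then show "x = y" by (rule node_unique[OF xy(1,2)])
qed

lemma cofactor_holomorphic: "m \<in> E \<Longrightarrow> cofactor m holomorphic_on UNIV"
proof -
  assume m: "m \<in> E"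
  then have W0: "W (a m) = 0" using W(2) by auto
  have "(\<lambda>z. if z = a m then deriv W (a m) else W z / (z - a m)) holomorphic_on UNIV"
    using pole_lemma_open[OF W(1) open_UNIV, of "a m"] by (simp only: W0 diff_zero)
  then show ?thesis
    unfolding cofactor_def by (intro holomorphic_intros)
qed

lemma cofactor_nonzero:
  assumes "m \<in> E" "cmod (m - z) < R / 2"
  shows "cofactor m z \<noteq> 0"
  using zero_in_disc[OF assms] W(3)[OF assms(1)] by (auto simp: cofactor_def)

lemma cofactor_mult: "m \<in> E \<Longrightarrow> cofactor m z * (a m - z) ^ 5 = W z ^ 5"
proof -
  assume m: "m \<in> E"
  have W0: "W (a m) = 0" using W(2) m by auto
  have "(a m - z) ^ 5 = - ((z - a m) ^ 5)"
    using power_minus_odd[of 5 "z - a m"] by simp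
  then show ?thesis using W0 by (auto simp: cofactor_def power_divide)
qed

lemma remainder_far:
  assumes "m \<in> E" "cmod (m - z) < R / 2" "k \<in> E - {m}"
  shows "R / 2 \<le> cmod (k - z)"
  using far_of_close[of m k z] assms by auto

lemma remainder_bound:
  assumes "m \<in> E" "cmod (m - z) < R / 2" "1 \<le> j" "j \<le> n"
  shows "cmod (remainder j m z) \<le> 1 / 4"
  using decaying_infsum_le[OF decaying[OF assms(3,4)], of "E - {m}" z] remainder_far[OF assms(1,2)]
  by (auto simp: remainder_def)

lemma remainder_holomorphic:
  assumes "m \<in> E" "1 \<le> j" "j \<le> n"
  shows "remainder j m holomorphic_on ball m (R / 2)"
  unfolding remainder_def
proof (rule decaying_infsum_holomorphic[OF decaying[OF assms(2,3)]])
  show "2 < cmod (k - z)" if "k \<in> E - {m}" "z \<in> ball m (R / 2)" for k z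
    using remainder_far[OF assms(1) _ that(1)] that(2) R_ge by (force simp: dist_norm)
qed auto

lemma local_rep_holomorphic:
  assumes "m \<in> E" "j \<le> n"
  shows "local_rep m j holomorphic_on ball m (R / 2)"
proof (cases "j = 0")
  case True
  then show ?thesis unfolding local_rep_def by (auto intro!: holomorphic_intros)
next
  case False
  then show ?thesis
    unfolding local_rep_def using remainder_holomorphic[OF assms(1), of j] assms(2)
    by (auto intro!: holomorphic_intros)
qed

lemma affine_rep_split:
  assumes "m \<in> E" "cmod (m - z) < R / 2" "1 \<le> j" "j \<le> n"
  shows "affine_rep j z = polar_term a s (p j) m z + remainder j m z"
proof -
  have "2 \<le> cmod (k - z)" if "k \<in> E - {m}" for k
    using remainder_far[OF assms(1,2) that] R_ge by simp
  then have "(\<lambda>k. polar_term a s (p j) k z) summable_on (E - {m})"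
    by (rule decaying_summable[OF decaying[OF assms(3,4)] Diff_subset])
  then show ?thesis
    using assms(1,3) infsum_insert[of "\<lambda>k. polar_term a s (p j) k z" "E - {m}" m]
    by (simp add: affine_rep_def remainder_def insert_absorb)
qed

text \<open>
  Off the pole both sides are \<open>W z ^ 5\<close> times the affine coordinate; at the pole this is the
  definition.
\<close>

lemma lift_near:
  assumes m: "m \<in> E" "cmod (m - z) < R / 2" and j: "j \<le> n"
  shows "lift j z = cofactor m z * local_rep m j z"
proof (cases "z = a m")
  case True
  then show ?thesis using m(1) by (auto simp: lift_def inj_on_nodes)
next
  case False
  then have W0: "W z \<noteq> 0" and z: "z \<notin> a ` E" using zero_in_disc[OF m] W(2) by auto
  have "a m - z \<noteq> 0" using False by simp
  show ?thesis
  proof (cases "j = 0")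
    case True
    then show ?thesis using z m(1) by (simp add: lift_def local_rep_def affine_rep_def cofactor_mult)
  next
    case False
    have "affine_rep j z = polar_term a s (p j) m z + remainder j m z"
      by (rule affine_rep_split[OF m]) (use False j in auto)
    also have "\<dots> * (a m - z) ^ 5 = local_rep m j z"
      using \<open>a m - z \<noteq> 0\<close> False by (simp add: polar_term_def local_rep_def distrib_right[of "_ / _"])
    finally show ?thesis
      using z by (simp add: lift_def ac_simps flip: cofactor_mult[OF m(1)])
  qed
qed

lemma lift_far:
  assumes "\<And>m. m \<in> E \<Longrightarrow> 2 < cmod (m - z)"
  shows "lift j z = W z ^ 5 * affine_rep j z" "W z \<noteq> 0"
proof -
  have "z \<notin> a ` E"
    using assms a(1) by (force simp: norm_minus_commute)
  then show "lift j z = W z ^ 5 * affine_rep j z" "W z \<noteq> 0"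
    using W(2) by (auto simp: lift_def)
qed

lemma affine_rep_holomorphic:
  assumes "open G" "\<And>m z. \<lbrakk>m \<in> E; z \<in> G\<rbrakk> \<Longrightarrow> 2 < cmod (m - z)" "j \<le> n"
  shows "affine_rep j holomorphic_on G"
proof (cases "j = 0")
  case False
  then show ?thesis
    unfolding affine_rep_def using decaying_infsum_holomorphic[OF decaying subset_refl assms(1,2)] assms(3)
    by simp
next
  case True
  then have "affine_rep j = (\<lambda>_. 1)" by (simp add: affine_rep_def fun_eq_iff)
  then show ?thesis by simp
qed

text \<open>
  The term of a node nearer than \<open>R / 2\<close>, if there is one, contributes at most $160/2^4=10$, and all
  other terms together at most $1/4$.
\<close>

lemma affine_rep_bound:
  assumes far: "\<And>m. m \<in> E \<Longrightarrow> 2 \<le> cmod (m - z)" and j: "j \<le> n"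
  shows "cmod (affine_rep j z) \<le> 11"
proof (cases "j = 0")
  case False
  have dec: "decaying 160 (polar_term a s (p j))" using False j by (intro decaying) auto
  show ?thesis
  proof (cases "\<exists>m\<in>E. cmod (m - z) < R / 2")
    case True
    then obtain m where m: "m \<in> E" "cmod (m - z) < R / 2" by blast
    have "cmod (polar_term a s (p j) m z) \<le> 160 / cmod (m - z) ^ 4"
      using dec m(1) far[OF m(1)] by (simp add: decaying_def)
    also have "\<dots> \<le> 160 / 2 ^ 4"
      using far[OF m(1)] by (intro divide_left_mono power_mono mult_pos_pos) auto
    finally have K: "cmod (polar_term a s (p j) m z) \<le> 10" by simp
    have "affine_rep j z = polar_term a s (p j) m z + remainder j m z"
      by (rule affine_rep_split[OF m]) (use False j in auto)
    then show ?thesis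
      using K remainder_bound[OF m, of j] False j norm_triangle_ineq[of "polar_term a s (p j) m z" "remainder j m z"]
      by simp
  next
    case none: False
    have "cmod (affine_rep j z) \<le> 160 / 640"
      unfolding affine_rep_def using False none decaying_infsum_le[OF dec subset_refl, of z] by force
    then show ?thesis by simp
  qed
qed (simp add: affine_rep_def)

text \<open>
  Within distance 3 of \<open>m\<close> the local representation is bounded, together with its derivative, by
  constants that do not depend on the data, and the dichotomy bounds one of its coordinates
  from below.
\<close>

lemma near_point_bound:
  assumes m: "m \<in> E" and z: "cmod (m - z) < 3"
  shows "spherical_formula n lift z \<le> curve_bound n"
    and "\<exists>j\<le>n. lift j z \<noteq> 0"
proof -
  have zR: "cmod (m - z) < R / 2" using z R_ge by simp
  define Q where "Q = (a m - z) ^ 5"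
  have zb: "z \<in> ball m (R / 2)" using zR by (simp add: dist_norm)
  have zc: "cball z 1 \<subseteq> ball m (R / 2)"
    using z R_ge by (simp add: cball_subset_ball_iff dist_norm norm_minus_commute)
  \<comment> \<open>Hence \<open>Q\<close> is at most \<open>4 ^ 5 = 1024\<close> and its derivative at most \<open>5 * 4 ^ 4 = 1280\<close>.\<close>
  have az: "cmod (a m - z) \<le> 4"
    using norm_triangle_ineq[of "a m - m" "m - z"] a(1)[OF m] z by simp
  have Q: "cmod Q \<le> 1024"
    unfolding Q_def norm_power using power_mono[OF az, of 5] by simp
  have dQ: "cmod (5 * (a m - z) ^ 4) \<le> 1280"
    using power_mono[OF az, of 4] by (simp add: norm_mult norm_power)
  have r: "cmod (remainder j m z) \<le> 1 / 4" "cmod (deriv (remainder j m) z) \<le> 1 / 4"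
      "remainder j m field_differentiable at z"
    if j: "1 \<le> j" "j \<le> n" for j
  proof -
    show "cmod (remainder j m z) \<le> 1 / 4" by (rule remainder_bound[OF m zR j])
    show "cmod (deriv (remainder j m) z) \<le> 1 / 4"
      using deriv_bound_cball[OF zero_less_one remainder_holomorphic[OF m j] zc, of "1 / 4"]
        remainder_bound[OF m _ j] zc by (force simp: dist_norm)
    show "remainder j m field_differentiable at z"
      using holomorphic_on_imp_differentiable_at[OF remainder_holomorphic[OF m j] open_ball zb] .
  qed
  have dlin: "((\<lambda>z. (a m - z) ^ 5) has_field_derivative - (5 * (a m - z) ^ 4)) (at z)"
    by (auto intro!: derivative_eq_intros)
  have P: "cmod (p j m + s m * (z - m)) \<le> 14" if "1 \<le> j" "j \<le> n" for j
  proof -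
    have "cmod (s m * (z - m)) \<le> 4 * 3"
      unfolding norm_mult using s_bound[OF m] z by (intro mult_mono) (auto simp: norm_minus_commute)
    then show ?thesis
      using norm_triangle_ineq[of "p j m" "s m * (z - m)"] p[OF m that] by simp
  qed
  have diff: "local_rep m j field_differentiable at z" if "j \<le> n" for j
    using holomorphic_on_imp_differentiable_at[OF local_rep_holomorphic[OF m that] open_ball zb] .
  have val: "cmod (local_rep m j z) \<le> 1280" and der: "cmod (deriv (local_rep m j) z) \<le> 1280" if j: "j \<le> n" for j
  proof -
    have "cmod (local_rep m j z) \<le> 1280 \<and> cmod (deriv (local_rep m j) z) \<le> 1280"
    proof (cases "j = 0")
      case True
      then have "local_rep m j = (\<lambda>z. (a m - z) ^ 5)" by (simp add: local_rep_def fun_eq_iff)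
      then show ?thesis using Q dQ DERIV_imp_deriv[OF dlin] by (simp add: Q_def)
    next
      case False
      then have j1: "1 \<le> j" by simp
      have rQ: "cmod (remainder j m z * Q) \<le> 1 / 4 * 1024"
        unfolding norm_mult using r(1)[OF j1 j] Q by (intro mult_mono) auto
      have v: "cmod (local_rep m j z) \<le> 1280"
        using False rQ P[OF j1 j] norm_triangle_ineq[of "p j m + s m * (z - m)" "remainder j m z * Q"]
        by (simp add: local_rep_def Q_def)
      have "(remainder j m has_field_derivative deriv (remainder j m) z) (at z)"
        using r(3)[OF j1 j] by (simp add: field_differentiable_derivI)
      then have "((\<lambda>z. p j m + s m * (z - m) + remainder j m z * (a m - z) ^ 5) has_field_derivative
          s m + (deriv (remainder j m) z * Q + remainder j m z * - (5 * (a m - z) ^ 4))) (at z)"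
        unfolding Q_def by (auto intro!: derivative_eq_intros)
      moreover have "local_rep m j = (\<lambda>z. p j m + s m * (z - m) + remainder j m z * (a m - z) ^ 5)"
        using False by (simp add: local_rep_def fun_eq_iff)
      ultimately have d: "deriv (local_rep m j) z =
          s m + (deriv (remainder j m) z * Q + remainder j m z * - (5 * (a m - z) ^ 4))"
        by (simp add: DERIV_imp_deriv)
      have "cmod (deriv (remainder j m) z * Q) \<le> 1 / 4 * 1024"
        unfolding norm_mult using r(2)[OF j1 j] Q by (intro mult_mono) auto
      moreover have "cmod (remainder j m z * - (5 * (a m - z) ^ 4)) \<le> 1 / 4 * 1280"
        unfolding norm_mult[of "remainder j m z"] norm_minus_cancel
        using r(1)[OF j1 j] dQ by (intro mult_mono) auto
      ultimately have "cmod (deriv (local_rep m j) z) \<le> 4 + (1 / 4 * 1024 + 1 / 4 * 1280)"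
        unfolding d using s_bound[OF m] by (intro norm_triangle_le add_mono) auto
      then show ?thesis using v by simp
    qed
    then show "cmod (local_rep m j z) \<le> 1280" "cmod (deriv (local_rep m j) z) \<le> 1280" by auto
  qed
  have rep0: "local_rep m 0 z = Q" by (simp add: local_rep_def Q_def)
  have big_P: "1 / 32 \<le> cmod (local_rep m j z)"
    if j: "1 \<le> j" "j \<le> n" and "3 / 4 \<le> cmod (p j m + s m * (z - m))" "cmod Q \<le> 1 / 32" for j
  proof -
    have "cmod (remainder j m z * Q) \<le> 1 / 4 * (1 / 32)"
      unfolding norm_mult using r(1)[OF j] that(4) by (intro mult_mono) auto
    then show ?thesis
      using norm_diff_ineq[of "p j m + s m * (z - m)" "remainder j m z * Q"] j that(3)
      by (simp add: local_rep_def Q_def)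
  qed
  have pj: "cmod (p j m - \<beta> m j) \<le> 1 / 4" if j: "1 \<le> j" "j \<le> n" for j
  proof -
    have "p j m - \<beta> m j = - (\<beta> m 0 * remainder j m m)"
      using p_eq[OF m j] by (simp add: remainder_def algebra_simps eq_diff_eq)
    moreover have "cmod (\<beta> m 0 * remainder j m m) \<le> 1 * (1 / 4)"
      unfolding norm_mult using beta[OF m, of 0] remainder_bound[OF m _ j] R_ge by (intro mult_mono) auto
    ultimately show ?thesis by simp
  qed
  \<comment> \<open>Where the denominator \<open>Q\<close> is small the numerators must be large. In the second case below
    \<open>z\<close> is then within distance \<open>1 / 2\<close> of the pole \<open>m + 1\<close>, hence at least \<open>1 / 2\<close> away from \<open>m\<close>,
    and the slope 4 contributes at least 2.\<close>
  have "\<exists>k\<le>n. 1 / 32 \<le> cmod (local_rep m k z)"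
  proof (cases "1 / 32 \<le> cmod Q")
    case True
    then show ?thesis using rep0 by (intro exI[of _ 0]) simp
  next
    case False
    then have Qs: "cmod Q \<le> 1 / 32" by simp
    from dichotomy[OF m] show ?thesis
    proof (elim disjE conjE bexE)
      fix j assume s: "s m = 0" and j: "j \<in> {1..n}" "cmod (\<beta> m j) = 1"
      have "3 / 4 \<le> cmod (p j m)"
        using pj[of j] j norm_triangle_ineq2[of "\<beta> m j" "p j m"] by (simp add: norm_minus_commute)
      then show ?thesis using big_P[of j] j(1) s Qs by auto
    next
      assume am: "a m = m + 1" and s: "s m = 4"
      have "cmod (1 - (z - m)) < 1 / 2"
      proof (rule ccontr)
        assume "\<not> ?thesis"
        then have "(1 / 2) ^ 5 \<le> cmod (1 - (z - m)) ^ 5" by (intro power_mono) auto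
        then show False using False by (simp add: Q_def am norm_power algebra_simps power_divide)
      qed
      then have "1 / 2 \<le> cmod (z - m)"
        using norm_triangle_ineq2[of 1 "z - m"] by simp
      moreover have "cmod (p 1 m) \<le> 5 / 4"
        using pj[of 1] n beta[OF m, of 1] norm_triangle_sub[of "p 1 m" "\<beta> m 1"] by simp
      ultimately have "3 / 4 \<le> cmod (p 1 m + s m * (z - m))"
        using norm_diff_ineq[of "s m * (z - m)" "p 1 m"] unfolding norm_mult s
        by (simp add: add.commute)
      then show ?thesis using big_P[of 1] n Qs by auto
    qed
  qed
  then obtain k where k: "k \<le> n" "1 / 32 \<le> cmod (local_rep m k z)" by blast
  have U: "cofactor m field_differentiable at z"
    using holomorphic_on_imp_differentiable_at[OF cofactor_holomorphic[OF m] open_UNIV UNIV_I] .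
  show "spherical_formula n lift z \<le> curve_bound n"
    unfolding curve_bound_def
  proof (rule spherical_formula_le[where u = "cofactor m" and v = "local_rep m" and k = k])
    fix j assume j: "j \<le> n"
    show "\<forall>\<^sub>F w in nhds z. lift j w = cofactor m w * local_rep m j w"
      using eventually_nhds_in_open[OF open_ball zb]
      by eventually_elim (rule lift_near[OF m _ j], simp add: dist_norm)
  qed (use U cofactor_nonzero[OF m zR] diff val der k in auto)
  show "\<exists>j\<le>n. lift j z \<noteq> 0"
    using k cofactor_nonzero[OF m zR] lift_near[OF m zR k(1)] by (intro exI[of _ k]) auto
qed

text \<open>
  Far from all nodes the affine coordinates themselves are a bounded representation, whose coordinate
  of index 0 is 1. On the disc of radius 1 about \<open>z\<close> the distance to the nodes still exceeds 2, so
  Cauchy's estimate on a smaller disc bounds the derivatives.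
\<close>

lemma far_point_bound:
  assumes far: "\<And>m. m \<in> E \<Longrightarrow> 3 \<le> cmod (m - z)"
  shows "spherical_formula n lift z \<le> curve_bound n"
    and "\<exists>j\<le>n. lift j z \<noteq> 0" and "\<And>j. j \<le> n \<Longrightarrow> lift j field_differentiable at z"
proof -
  have G: "2 < cmod (m - w)" if "m \<in> E" "w \<in> ball z 1" for m w
    using norm_triangle_ineq2[of "m - z" "w - z"] far[OF that(1)] that(2)
    by (simp add: dist_norm norm_minus_commute)
  have hol: "affine_rep j holomorphic_on ball z 1" if "j \<le> n" for j
    by (rule affine_rep_holomorphic[OF open_ball G that])
  have diff: "affine_rep j field_differentiable at z" if "j \<le> n" for j
    using holomorphic_on_imp_differentiable_at[OF hol[OF that] open_ball] by simp
  have val: "cmod (affine_rep j w) \<le> 11" if "j \<le> n" "w \<in> ball z 1" for j w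
    by (rule affine_rep_bound[OF less_imp_le[OF G[OF _ that(2)]] that(1)])
  have half: "cball z (1 / 2) \<subseteq> ball z 1" by (simp add: cball_subset_ball_iff)
  have der: "cmod (deriv (affine_rep j) z) \<le> 11 / (1 / 2)" if "j \<le> n" for j
    by (rule deriv_bound_cball[OF _ hol[OF that] half val[OF that]]) (use half in auto)
  have W5: "(\<lambda>z. W z ^ 5) holomorphic_on UNIV" by (intro holomorphic_intros W)
  have U: "(\<lambda>z. W z ^ 5) field_differentiable at z"
    using holomorphic_on_imp_differentiable_at[OF W5 open_UNIV UNIV_I] .
  have z1: "z \<in> ball z 1" by simp
  have near: "lift j w = W w ^ 5 * affine_rep j w" "W w \<noteq> 0" if "w \<in> ball z 1" for j w
    using lift_far[OF G[OF _ that]] by auto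
  have ev: "\<forall>\<^sub>F w in nhds z. lift j w = W w ^ 5 * affine_rep j w" for j
    using eventually_nhds_in_open[OF open_ball z1] by eventually_elim (rule near)
  show "spherical_formula n lift z \<le> curve_bound n"
    unfolding curve_bound_def
  proof (rule spherical_formula_le[OF U _ diff ev])
    show "cmod (affine_rep j z) \<le> 1280" if "j \<le> n" for j using val[OF that z1] by simp
    show "cmod (deriv (affine_rep j) z) \<le> 1280" if "j \<le> n" for j using der[OF that] by simp
    show "1 / 32 \<le> cmod (affine_rep 0 z)" by (simp add: affine_rep_def)
  qed (use near(2)[OF z1] in auto)
  show "\<exists>j\<le>n. lift j z \<noteq> 0"
    using near(1)[OF z1, of 0] near(2)[OF z1] by (intro exI[of _ 0]) (simp add: affine_rep_def)
  show "lift j field_differentiable at z" if "j \<le> n" for j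
  proof (rule field_differentiable_transform_within)
    show "(\<lambda>w. W w ^ 5 * affine_rep j w) field_differentiable at z"
      by (intro field_differentiable_mult U diff that)
    show "W w ^ 5 * affine_rep j w = lift j w" if "dist w z < 1" for w
      using near(1)[of w] that by (simp add: dist_commute)
  qed auto
qed

lemma lift_homogeneous:
  shows "\<And>j. j \<le> n \<Longrightarrow> lift j holomorphic_on UNIV"
    and "\<And>z. \<exists>j\<le>n. lift j z \<noteq> 0"
    and "\<And>z. spherical_formula n lift z \<le> curve_bound n"
    and "\<And>m. m \<in> E \<Longrightarrow> proj_point n (\<lambda>j. lift j m) = proj_point n (\<beta> m)"
proof -
  have near_or_far: "(\<exists>m\<in>E. cmod (m - z) < 3) \<or> (\<forall>m\<in>E. 3 \<le> cmod (m - z))" for z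
    by force
  show "\<exists>j\<le>n. lift j z \<noteq> 0" for z
    using near_or_far[of z] near_point_bound(2) far_point_bound(2) by blast
  show "spherical_formula n lift z \<le> curve_bound n" for z
    using near_or_far[of z] near_point_bound(1) far_point_bound(1) by blast
  show "lift j holomorphic_on UNIV" if j: "j \<le> n" for j
  proof -
    have "lift j field_differentiable at z" for z
      using near_or_far[of z]
    proof
      assume "\<exists>m\<in>E. cmod (m - z) < 3"
      then obtain m where m: "m \<in> E" "cmod (m - z) < 3" by blast
      then have zb: "z \<in> ball m (R / 2)" using R_ge by (simp add: dist_norm)
      have "(\<lambda>w. cofactor m w * local_rep m j w) holomorphic_on ball m (R / 2)"
        using holomorphic_on_subset[OF cofactor_holomorphic[OF m(1)]] local_rep_holomorphic[OF m(1) j]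
        by (intro holomorphic_intros) auto
      then have "lift j holomorphic_on ball m (R / 2)"
        by (rule holomorphic_transform) (simp add: lift_near[OF m(1) _ j] dist_norm)
      then show ?thesis
        using holomorphic_on_imp_differentiable_at[OF _ open_ball zb] by blast
    next
      assume "\<forall>m\<in>E. 3 \<le> cmod (m - z)"
      then show ?thesis using far_point_bound(3)[OF _ j] by blast
    qed
    then show ?thesis by (simp add: holomorphic_on_def)
  qed
  show "proj_point n (\<lambda>j. lift j m) = proj_point n (\<beta> m)" if m: "m \<in> E" for m
  proof -
    have mR: "cmod (m - m) < R / 2" using R_ge by simp
    have eq: "local_rep m j m = \<beta> m j" if "j \<le> n" for j
      using p_eq[OF m, of j] a(2)[OF m] that by (cases "j = 0") (auto simp: local_rep_def remainder_def mult.commute)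
    show ?thesis
    proof (rule proj_point_scale[OF cofactor_nonzero[OF m mR]])
      show "lift j m = cofactor m m * \<beta> m j" if "j \<le> n" for j
        using lift_near[OF m mR that] eq[OF that] by simp
      show "\<exists>j\<le>n. \<beta> m j \<noteq> 0"
        using dichotomy[OF m] by force
    qed
  qed
qed

end

section \<open>Interpolation by Brody curves\<close>

lemma fifth_root:
  fixes w :: complex
  assumes "cmod w \<le> 1"
  obtains b where "b ^ 5 = w" "cmod b \<le> 1"
proof -
  obtain b where b: "b ^ 5 = w"
    using exists_complex_root[of 5 w] by auto
  have "cmod b \<le> 1"
  proof (rule ccontr)
    assume "\<not> ?thesis"
    then have "1 < cmod b ^ 5" by simp
    then show False using assms b by (auto simp flip: norm_power)
  qed
  then show thesis using that b by blast
qed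

text \<open>
  The pole near \<open>m\<close> is displaced by a fifth root of the coordinate of index 0, the root 1 being chosen
  when that coordinate is 1, as the first alternative of the dichotomy needs.
\<close>

lemma (in separated_set) projective_interpolation:
  assumes n: "1 \<le> n" and b: "b \<in> E \<rightarrow> proj_space n"
  obtains f where "\<And>j. j \<le> n \<Longrightarrow> f j holomorphic_on UNIV" "\<And>z. \<exists>j\<le>n. f j z \<noteq> 0"
    "\<And>z. spherical_formula n f z \<le> curve_bound n"
    "\<And>m. m \<in> E \<Longrightarrow> proj_point n (\<lambda>j. f j m) = b m"
proof -
  have "\<exists>\<beta>. (\<forall>j\<le>n. cmod (\<beta> j) \<le> 1) \<and> b m = proj_point n \<beta> \<and>
      (\<beta> 0 = 1 \<or> (\<exists>j\<in>{1..n}. cmod (\<beta> j) = 1))" if m: "m \<in> E" for m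
  proof -
    have "b m \<in> proj_space n" using b m by auto
    then show ?thesis by (rule normalized_coordinates) blast
  qed
  then obtain \<beta> where coords: "\<And>m j. m \<in> E \<Longrightarrow> j \<le> n \<Longrightarrow> cmod (\<beta> m j) \<le> 1"
      "\<And>m. m \<in> E \<Longrightarrow> b m = proj_point n (\<beta> m)"
      "\<And>m. m \<in> E \<Longrightarrow> \<beta> m 0 = 1 \<or> (\<exists>j\<in>{1..n}. cmod (\<beta> m j) = 1)"
    by metis
  have "\<exists>d. d ^ 5 = \<beta> m 0 \<and> cmod d \<le> 1 \<and> (\<beta> m 0 = 1 \<longrightarrow> d = 1)" if m: "m \<in> E" for m
  proof (cases "\<beta> m 0 = 1")
    case False
    then show ?thesis using fifth_root[OF coords(1)[OF m, of 0]] by auto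
  qed auto
  then obtain d where d: "\<And>m. m \<in> E \<Longrightarrow> d m ^ 5 = \<beta> m 0" "\<And>m. m \<in> E \<Longrightarrow> cmod (d m) \<le> 1"
      "\<And>m. m \<in> E \<Longrightarrow> \<beta> m 0 = 1 \<Longrightarrow> d m = 1"
    by metis
  define a where "a = (\<lambda>m. m + d m)"
  define s :: "complex \<Rightarrow> complex" where "s = (\<lambda>m. if \<beta> m 0 = 1 then 4 else 0)"
  have a1: "cmod (a m - m) \<le> 1" if "m \<in> E" for m using d(2)[OF that] by (simp add: a_def)
  have "\<exists>p. (\<forall>m\<in>E. cmod (p m) \<le> 2 \<and>
      p m + \<beta> m 0 * (\<Sum>\<^sub>\<infinity>k\<in>E - {m}. polar_term a s p k m) = \<beta> m j)" if "j \<le> n" for j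
    by (rule interpolation_fixpoint[of a s "\<lambda>m. \<beta> m 0" "\<lambda>m. \<beta> m j"])
       (use a1 coords(1) that in \<open>auto simp: s_def\<close>)
  then obtain p where p: "\<And>j m. j \<le> n \<Longrightarrow> m \<in> E \<Longrightarrow> cmod (p j m) \<le> 2"
      "\<And>j m. j \<le> n \<Longrightarrow> m \<in> E \<Longrightarrow> p j m + \<beta> m 0 * (\<Sum>\<^sub>\<infinity>k\<in>E - {m}. polar_term a s (p j) k m) = \<beta> m j"
    by metis
  have "finite (a ` E \<inter> cball 0 r)" for r
  proof (rule finite_subset)
    show "a ` E \<inter> cball 0 r \<subseteq> a ` (E \<inter> cball 0 (r + 1))"
    proof
      fix w assume "w \<in> a ` E \<inter> cball 0 r"
      then obtain m where m: "m \<in> E" "w = a m" "cmod (a m) \<le> r" by auto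
      then have "cmod m \<le> r + 1"
        using a1[of m] norm_triangle_sub[of m "a m"] by (simp add: norm_minus_commute)
      then show "w \<in> a ` (E \<inter> cball 0 (r + 1))" using m by auto
    qed
    show "finite (a ` (E \<inter> cball 0 (r + 1)))"
      using finite_sparse_set_cball[OF _ sparse] R_ge by simp
  qed
  then obtain W where W: "W holomorphic_on UNIV" "\<And>z. W z = 0 \<longleftrightarrow> z \<in> a ` E"
      "\<And>w. w \<in> a ` E \<Longrightarrow> deriv W w \<noteq> 0"
    using weierstrass_simple_zeros[of "a ` E"] by metis
  interpret interpolation_data R E n \<beta> a s p W
  proof
    show "\<beta> m 0 = 1 \<and> a m = m + 1 \<and> s m = 4 \<or> s m = 0 \<and> (\<exists>j\<in>{1..n}. cmod (\<beta> m j) = 1)"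
      if "m \<in> E" for m
      using coords(3)[OF that] d(3)[OF that] by (auto simp: a_def s_def)
  qed (use n coords a1 d p W in \<open>auto simp: a_def\<close>)
  show thesis
    by (rule that[of lift]) (use lift_homogeneous coords(2) in auto)
qed

text \<open>
  Scaling the plane by \<open>R / K\<close> turns a \<open>K\<close>-sparse set into an \<open>R\<close>-sparse one and multiplies spherical
  derivatives by \<open>R / K\<close>.
\<close>

theorem theorem2p4:
  fixes n :: nat
  assumes "n \<ge> 1"
  shows "\<exists>C::real. C > 0 \<and>
           (\<forall>K::real. K > 0 \<longrightarrow>
             (\<forall>(E :: complex set) (b :: complex \<Rightarrow> (nat \<Rightarrow> complex) set).
               sparse_set K E \<longrightarrow> b \<in> E \<rightarrow> proj_space n \<longrightarrow>
               (\<exists>f \<in> brody_curves n (C / K). \<forall>m\<in>E. f m = b m)))"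
proof -
  obtain R :: real where R: "8 \<le> R" "\<And>E. sparse_set R E \<Longrightarrow> separated_set R E"
    using separation_radius_exists by blast
  define C where "C = curve_bound n"
  have "C > 0" by (simp add: C_def curve_bound_def)
  show ?thesis
  proof (intro exI[of _ "R * C"] conjI allI impI)
    show "R * C > 0" using R \<open>C > 0\<close> by simp
    fix K :: real and E :: "complex set" and b :: "complex \<Rightarrow> (nat \<Rightarrow> complex) set"
    assume K: "K > 0" and E: "sparse_set K E" and b: "b \<in> E \<rightarrow> proj_space n"
    define c where "c = R / K"
    have c: "c > 0" using R K by (simp add: c_def)
    define E' where "E' = (\<lambda>m. of_real c * m) ` E"
    have "sparse_set R E'"
      unfolding sparse_set_def
    proof (intro ballI impI)
      fix x y assume "x \<in> E'" "y \<in> E'" "x \<noteq> y"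
      then obtain x0 y0 where xy: "x0 \<in> E" "y0 \<in> E" "x = of_real c * x0" "y = of_real c * y0" "x0 \<noteq> y0"
        by (auto simp: E'_def)
      then have "K \<le> dist x0 y0" using E by (auto simp: sparse_set_def)
      then have "c * K \<le> c * dist x0 y0" using c by simp
      also have "c * dist x0 y0 = dist x y"
        using c unfolding xy dist_norm right_diff_distrib[symmetric] norm_mult by simp
      finally show "R \<le> dist x y" using K by (simp add: c_def)
    qed
    then interpret separated_set R E' by (rule R(2))
    define b' where "b' = (\<lambda>w. b (w / of_real c))"
    have b': "b' \<in> E' \<rightarrow> proj_space n"
      using b c by (auto simp: b'_def E'_def)
    obtain f where f: "\<And>j. j \<le> n \<Longrightarrow> f j holomorphic_on UNIV" "\<And>z. \<exists>j\<le>n. f j z \<noteq> 0"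
        "\<And>z. spherical_formula n f z \<le> C" "\<And>m. m \<in> E' \<Longrightarrow> proj_point n (\<lambda>j. f j m) = b' m"
      using projective_interpolation[OF assms b'] unfolding C_def by metis
    define g where "g = (\<lambda>j z. f j (of_real c * z))"
    define F where "F = (\<lambda>z. proj_point n (\<lambda>j. g j z))"
    have rep: "homogeneous_rep n g F"
      unfolding homogeneous_rep_def
    proof (intro conjI allI impI)
      fix j assume "j \<le> n"
      then show "g j holomorphic_on UNIV"
        unfolding g_def using holomorphic_on_compose_gen[of "\<lambda>z. of_real c * z" UNIV "f j" UNIV] f(1)
        by (auto simp: o_def intro!: holomorphic_intros)
    qed (use f(2) in \<open>auto simp: g_def F_def\<close>)
    have "spherical_deriv n F z \<le> R * C / K" for z
    proof -
      have "spherical_deriv n F z = c * spherical_formula n f (of_real c * z)"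
        unfolding spherical_deriv_eq[OF rep] g_def by (rule spherical_formula_rescale[OF f(1) c])
      also have "\<dots> \<le> c * C" using f(3) c by simp
      finally show ?thesis by (simp add: c_def)
    qed
    then have "F \<in> brody_curves n (R * C / K)"
      unfolding brody_curves_def using homogeneous_rep_imp_holomorphic_curve[OF rep] by simp
    moreover have "F m = b m" if "m \<in> E" for m
      using f(4)[of "of_real c * m"] that c by (simp add: F_def g_def b'_def E'_def)
    ultimately show "\<exists>f \<in> brody_curves n (R * C / K). \<forall>m\<in>E. f m = b m" by blast
  qed
qed

end
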